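(* Let $X_1,X_2,\dots$ be independent random variables with $\mathbb{E}X_i=0$ and $\mathbb{E}X_i^2=\sigma^2\in(0,\infty)$, and let $N\sim\mathrm{Geo}(p)$, $p\in(0,1)$, be independent of the $X_i$. Let $W=p^{1/2}\sum_{i=1}^NX_i$ and $Z\sim\mathrm{Laplace}(0,\sigma/\sqrt2)$. Then $$d_{\mathrm K}(W,Z)\le17.04\frac{p^{1/2}}\sigma\sup_{i\ge1}\|F_{X_i}^{-1}-F_{X_i^L}^{-1}\|.$$ If in addition $\rho=\sup_{i\ge1}\mathbb{E}|X_i|^3<\infty$, then $$d_{\mathrm W}(W,Z)\le12p^{1/2}\Big(\sigma+\frac\rho{3\sigma^2}\Big).$$ Moreover, the order $p^{1/2}$ in the Wasserstein bound cannot be improved in general: if the $X_i$ are i.i.d. with moments of all orders and $\mathbb{E}X_1^3\neq0$, then $d_{\mathrm W}(W,Z)\ge cp^{1/2}$ for some $c>0$ and all sufficiently small $p$.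
   Context: $\mathrm{Geo}(p)$ is the distribution with $\mathbb{P}(N=k)=p(1-p)^{k-1}$, $k\ge1$. For $b>0$, $\mathrm{Laplace}(0,b)$ has density $\frac1{2b}e^{-|x|/b}$. For a mean-zero random variable $X$ with finite nonzero variance, $X^L$ has the $X$-centered equilibrium distribution if $\mathbb{E}f(X)-f(0)=\frac12\mathbb{E}X^2\,\mathbb{E}f''(X^L)$ for all twice-differentiable $f$ for which the expectations exist. $F_X$ is the distribution function of $X$, $F_X^{-1}$ its generalized inverse, and $\|F_X^{-1}-F_Y^{-1}\|=\sup_{u\in(0,1)}|F_X^{-1}(u)-F_Y^{-1}(u)|$. $d_{\mathrm K}$ is the Kolmogorov distance and $d_{\mathrm W}$ the Wasserstein distance (sup over Lipschitz test functions with constant $\le1$). *)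

theory Defs
  imports "HOL-Probability.Probability"
begin

definition geometric_rv :: "'a measure \<Rightarrow> real \<Rightarrow> ('a \<Rightarrow> nat) \<Rightarrow> bool" where
  "geometric_rv M p N \<longleftrightarrow> N \<in> measurable M (count_space UNIV) \<and>
     (\<forall>k::nat. k \<ge> 1 \<longrightarrow> measure M {\<omega> \<in> space M. N \<omega> = k} = p * (1 - p) ^ (k - 1))"

text \<open>N is independent of the whole sequence (X_i), i >= 1: expressed as joint independence of
  (N, X_1, X_2, ...), which (given that the X_i are mutually independent) is equivalent.\<close>
definition indep_of_seq :: "'a measure \<Rightarrow> ('a \<Rightarrow> nat) \<Rightarrow> (nat \<Rightarrow> 'a \<Rightarrow> real) \<Rightarrow> bool" where
  "indep_of_seq M N X \<longleftrightarrow>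
     prob_space.indep_vars M (\<lambda>_. borel) (\<lambda>i \<omega>. if i = 0 then real (N \<omega>) else X i \<omega>) UNIV"

definition compound_W :: "real \<Rightarrow> ('a \<Rightarrow> nat) \<Rightarrow> (nat \<Rightarrow> 'a \<Rightarrow> real) \<Rightarrow> 'a \<Rightarrow> real" where
  "compound_W p N X \<omega> = sqrt p * (\<Sum>i = 1..N \<omega>. X i \<omega>)"

definition laplace_density :: "real \<Rightarrow> real \<Rightarrow> real" where
  "laplace_density b x = exp (- \<bar>x\<bar> / b) / (2 * b)"

definition laplace_measure :: "real \<Rightarrow> real measure" where
  "laplace_measure b = density lborel (\<lambda>x. ennreal (laplace_density b x))"

definition cdf_of :: "real measure \<Rightarrow> real \<Rightarrow> real" where
  "cdf_of \<mu> x = measure \<mu> {..x}"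

definition gen_inverse :: "real measure \<Rightarrow> real \<Rightarrow> real" where
  "gen_inverse \<mu> u = Inf {x. cdf_of \<mu> x \<ge> u}"

definition quantile_dist :: "real measure \<Rightarrow> real measure \<Rightarrow> ereal" where
  "quantile_dist \<mu> \<nu> = (SUP u\<in>{0<..<1}. ereal \<bar>gen_inverse \<mu> u - gen_inverse \<nu> u\<bar>)"

definition kolmogorov_dist :: "real measure \<Rightarrow> real measure \<Rightarrow> ereal" where
  "kolmogorov_dist \<mu> \<nu> = (SUP x. ereal \<bar>cdf_of \<mu> x - cdf_of \<nu> x\<bar>)"

definition wasserstein_dist :: "real measure \<Rightarrow> real measure \<Rightarrow> ereal" where
  "wasserstein_dist \<mu> \<nu> =
     (SUP h\<in>{h :: real \<Rightarrow> real. \<forall>x y. \<bar>h x - h y\<bar> \<le> \<bar>x - y\<bar>}.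
        ereal \<bar>(\<integral>x. h x \<partial>\<mu>) - (\<integral>x. h x \<partial>\<nu>)\<bar>)"

text \<open>L is the law of X^L, the X-centered equilibrium distribution, where \<mu> is the law of X:
  E f(X) - f(0) = 1/2 E X^2 E f''(X^L) for all twice differentiable f for which the
  expectations exist.\<close>
definition centered_equilibrium :: "real measure \<Rightarrow> real measure \<Rightarrow> bool" where
  "centered_equilibrium \<mu> L \<longleftrightarrow> prob_space L \<and> sets L = sets borel \<and>
     (\<forall>f f' f''. (\<forall>x. (f has_real_derivative f' x) (at x)) \<longrightarrow>
                (\<forall>x. (f' has_real_derivative f'' x) (at x)) \<longrightarrow>
                integrable \<mu> f \<longrightarrow> integrable L f'' \<longrightarrow>
                (\<integral>x. f x \<partial>\<mu>) - f 0 = 1/2 * (\<integral>x. x ^ 2 \<partial>\<mu>) * (\<integral>x. f'' x \<partial>L))"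

end

theory Submission
  imports Defs
begin

text \<open>
  Put \<open>b = \<sigma> / sqrt 2\<close>. For a Lipschitz function \<open>h\<close> the convolution \<open>g\<close> of \<open>h\<close> with the Laplace law
  solves \<open>g - b\<^sup>2 g'' = h\<close>, and \<open>g 0\<close> is the expectation of \<open>h(Z)\<close>; \<open>g\<close> inherits the Lipschitz
  constant of \<open>h\<close>, and \<open>g'\<close> is bounded by \<open>1/b\<close> if \<open>h\<close> is bounded by 1.
  Let \<open>S n\<close> be the partial sums scaled by \<open>sqrt p\<close>. Summation by parts against the geometric weights gives
  \<open>E h(W) - g 0 = (\<Sum>n. (1-p)^n (p E (h-g)(S (n+1)) + E g(S (n+1)) - E g(S n)))\<close>,
  and to leading order \<open>E g(S (n+1)) - E g(S n)\<close> is \<open>p b\<^sup>2 E g''(S n) = p E (g-h)(S n)\<close>, so every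
  summand is small.

  For the Kolmogorov bound the increment is expressed exactly through the equilibrium distribution,
  which is coupled to the law of \<open>X i\<close> by quantiles; \<open>h\<close> is a piecewise linear ramp whose width is the
  coupling distance, and the Laplace density bounds the resulting shift of the threshold. For the Wasserstein
  bound a Taylor expansion of second order suffices, since \<open>g''\<close> is Lipschitz. The constants obtained are
  \<open>2 sqrt 2\<close> and 2.

  For the lower bound the test function is \<open>sin\<close>, whose Laplace mean vanishes: if \<open>\<phi>\<close> is the
  characteristic function of \<open>X 1\<close> at \<open>sqrt p\<close>, then \<open>E sin W = p Im \<phi> / |1 - (1-p) \<phi>|\<^sup>2\<close>, where
  \<open>Im \<phi>\<close> is asymptotic to \<open>- p powr (3/2) E (X 1)^3 / 6\<close> and the denominator is of order \<open>p\<^sup>2\<close>.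
\<close>

subsection \<open>Smoothing by the Laplace distribution\<close>

definition exp_average :: "real \<Rightarrow> (real \<Rightarrow> real) \<Rightarrow> real \<Rightarrow> real" where
  "exp_average c h x = (\<integral>t. indicator {0..} t * exp (-t) * h (x - c * t) \<partial>lborel)"

text \<open>\<open>Laplace(0, b)\<close> is the equal mixture of the laws of \<open>b * T\<close>
  and \<open>- b * T\<close>, so this is the convolution of \<open>h\<close> with that law. The two
  one-sided averages are kept apart because each solves a first-order equation.\<close>

definition laplace_smoothing :: "real \<Rightarrow> (real \<Rightarrow> real) \<Rightarrow> real \<Rightarrow> real" where
  "laplace_smoothing b h x = (exp_average b h x + exp_average (-b) h x) / 2"

lemma lipschitz_on_real_iff:
  "K-lipschitz_on UNIV (h :: real \<Rightarrow> real) \<longleftrightarrow> 0 \<le> K \<and> (\<forall>x y. \<bar>h x - h y\<bar> \<le> K * \<bar>x - y\<bar>)"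
  by (auto simp: lipschitz_on_def dist_real_def)

lemma lipschitz_linear_growth:
  fixes h :: "real \<Rightarrow> real"
  assumes "K-lipschitz_on UNIV h"
  shows "\<bar>h x\<bar> \<le> \<bar>h 0\<bar> + K * \<bar>x\<bar>"
proof -
  have "\<bar>h x - h 0\<bar> \<le> K * \<bar>x - 0\<bar>"
    using assms unfolding lipschitz_on_real_iff by blast
  then show ?thesis by simp
qed

lemma lipschitz_borel_measurable:
  fixes h :: "real \<Rightarrow> real"
  assumes "K-lipschitz_on UNIV h"
  shows "h \<in> borel_measurable borel"
  using lipschitz_on_continuous_on[OF assms] by (rule borel_measurable_continuous_onI)

lemma integrable_exp_power:
  "integrable lborel (\<lambda>t::real. indicator {0..} t * exp (-t) * t ^ k)"
  using has_bochner_integral_I0i_power_exp_m'[of k]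
  by (auto simp: has_bochner_integral_iff mult_ac)

lemma integral_exp:
  "(\<integral>t. indicator {0..} t * exp (-t) \<partial>lborel) = (1::real)"
  using has_bochner_integral_I0i_power_exp_m'[of 0]
  by (auto simp: has_bochner_integral_iff mult_ac)

lemma exp_average_integrable:
  fixes h :: "real \<Rightarrow> real"
  assumes "K-lipschitz_on UNIV h"
  shows "integrable lborel (\<lambda>t. indicator {0..} t * exp (-t) * h (x - c * t))"
proof (rule Bochner_Integration.integrable_bound)
  have [measurable]: "h \<in> borel_measurable borel"
    by (rule lipschitz_borel_measurable[OF assms])
  have K: "0 \<le> K" using assms by (simp add: lipschitz_on_def)
  show "integrable lborel (\<lambda>t::real. (\<bar>h 0\<bar> + K * \<bar>x\<bar>) * (indicator {0..} t * exp (-t) * t ^ 0)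
          + K * \<bar>c\<bar> * (indicator {0..} t * exp (-t) * t ^ 1))"
    by (intro Bochner_Integration.integrable_add integrable_mult_right integrable_exp_power)
  show "(\<lambda>t. indicator {0..} t * exp (-t) * h (x - c * t)) \<in> borel_measurable lborel"
    by measurable
  have "\<bar>h (x - c * t)\<bar> \<le> (\<bar>h 0\<bar> + K * \<bar>x\<bar>) + K * \<bar>c\<bar> * t" if "0 \<le> t" for t
  proof -
    have "\<bar>x - c * t\<bar> \<le> \<bar>x\<bar> + \<bar>c\<bar> * t"
      using that by (metis abs_mult abs_of_nonneg abs_triangle_ineq4)
    then have "K * \<bar>x - c * t\<bar> \<le> K * (\<bar>x\<bar> + \<bar>c\<bar> * t)"
      using K by (intro mult_left_mono)
    then show ?thesis
      using lipschitz_linear_growth[OF assms, of "x - c * t"] by (simp add: algebra_simps)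
  qed
  then have "exp (-t) * \<bar>h (x - c * t)\<bar> \<le> exp (-t) * ((\<bar>h 0\<bar> + K * \<bar>x\<bar>) + K * \<bar>c\<bar> * t)" if "0 \<le> t" for t
    using that by (intro mult_left_mono) auto
  then show "AE t in lborel. norm (indicator {0..} t * exp (-t) * h (x - c * t))
      \<le> norm ((\<bar>h 0\<bar> + K * \<bar>x\<bar>) * (indicator {0..} t * exp (-t) * t ^ 0)
          + K * \<bar>c\<bar> * (indicator {0..} t * exp (-t) * t ^ 1))"
    using K by (intro AE_I2) (auto simp: abs_mult indicator_def algebra_simps abs_of_nonneg)
qed

text \<open>The weight \<open>exp (-t)\<close> on the half-line has total mass 1, so a pointwise
  bound survives averaging. With \<open>h = k\<close> this gives the Lipschitz bound, with
  \<open>k = 0\<close> the supremum bound.\<close>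

lemma exp_average_diff_le:
  assumes h: "K-lipschitz_on UNIV h" and k: "K'-lipschitz_on UNIV k"
    and le: "\<And>t. 0 \<le> t \<Longrightarrow> \<bar>h (x - c * t) - k (y - c * t)\<bar> \<le> D"
  shows "\<bar>exp_average c h x - exp_average c k y\<bar> \<le> D"
proof -
  let ?e = "\<lambda>t::real. indicator {0..} t * exp (-t) :: real"
  have "\<bar>exp_average c h x - exp_average c k y\<bar> =
      \<bar>\<integral>t. ?e t * h (x - c * t) - ?e t * k (y - c * t) \<partial>lborel\<bar>"
    unfolding exp_average_def
    by (subst Bochner_Integration.integral_diff) (auto intro: exp_average_integrable[OF h] exp_average_integrable[OF k])
  also have "\<dots> \<le> (\<integral>t. \<bar>?e t * h (x - c * t) - ?e t * k (y - c * t)\<bar> \<partial>lborel)"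
    by (rule integral_abs_bound)
  also have "\<dots> \<le> (\<integral>t. ?e t * D \<partial>lborel)"
  proof (rule integral_mono)
    show "integrable lborel (\<lambda>t. \<bar>?e t * h (x - c * t) - ?e t * k (y - c * t)\<bar>)"
      by (intro integrable_abs Bochner_Integration.integrable_diff exp_average_integrable[OF h] exp_average_integrable[OF k])
    show "integrable lborel (\<lambda>t. ?e t * D)"
      using integrable_exp_power[of 0] by (auto intro!: integrable_mult_left)
    fix t
    show "\<bar>?e t * h (x - c * t) - ?e t * k (y - c * t)\<bar> \<le> ?e t * D"
      using le[of t] by (auto simp: indicator_def abs_mult simp flip: right_diff_distrib)
  qed
  also have "\<dots> = D"
    by (subst integral_mult_left_zero) (simp add: integral_exp)
  finally show ?thesis .
qed

lemma exp_average_lipschitz: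
  assumes "K-lipschitz_on UNIV h"
  shows "K-lipschitz_on UNIV (exp_average c h)"
  unfolding lipschitz_on_real_iff
proof (intro conjI allI exp_average_diff_le[OF assms assms])
  fix x y t
  have "\<bar>h (x - c * t) - h (y - c * t)\<bar> \<le> K * \<bar>(x - c * t) - (y - c * t)\<bar>"
    using assms unfolding lipschitz_on_real_iff by blast
  then show "\<bar>h (x - c * t) - h (y - c * t)\<bar> \<le> K * \<bar>x - y\<bar>" by simp
qed (use assms in \<open>simp add: lipschitz_on_def\<close>)

lemma exp_average_bound:
  assumes "K-lipschitz_on UNIV h" and "\<And>x. \<bar>h x\<bar> \<le> C"
  shows "\<bar>exp_average c h x\<bar> \<le> C"
proof -
  have "\<bar>exp_average c h x - exp_average c (\<lambda>_. 0) x\<bar> \<le> C"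
    by (rule exp_average_diff_le[OF assms(1), of 0]) (use assms in \<open>auto simp: lipschitz_on_real_iff\<close>)
  then show ?thesis by (simp add: exp_average_def)
qed

section \<open>The first-order differential equation of an exponential average\<close>

lemma exp_average_reflect:
  "exp_average (-c) h x = exp_average c (\<lambda>y. h (-y)) (-x)"
  unfolding exp_average_def by (simp add: add.commute)

text \<open>Pointwise form of the substitution \<open>y = x - c * t\<close>, used for both the value
  and the integrability of the tail integral.\<close>

lemma exp_tail_substitution:
  fixes c :: real and h :: "real \<Rightarrow> real"
  assumes c: "0 < c"
  shows "indicator {..x} (x - c * t) * (exp ((x - c * t)/c) * h (x - c * t)) =
    exp (x/c) * (indicator {0..} t * exp (-t) * h (x - c * t))"
proof -
  have "(x - c * t)/c = x/c + (-t)" using c by (simp add: field_simps)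
  moreover have "x - c * t \<le> x \<longleftrightarrow> 0 \<le> t" using c by (simp add: zero_le_mult_iff)
  ultimately show ?thesis by (simp only: exp_add) (auto simp: indicator_def)
qed

text \<open>The substitution moves \<open>x\<close> from the argument of \<open>h\<close> into an
  integration limit and an explicit prefactor, where continuity of \<open>h\<close> is enough for
  differentiation.\<close>

lemma exp_average_eq_tail_integral:
  assumes c: "0 < c"
  shows "exp_average c h x = exp (-x/c) / c * (\<integral>y. indicator {..x} y * (exp (y/c) * h y) \<partial>lborel)"
proof -
  have "(\<integral>y. indicator {..x} y * (exp (y/c) * h y) \<partial>lborel) =
      c * (\<integral>t. indicator {..x} (x - c * t) * (exp ((x - c * t)/c) * h (x - c * t)) \<partial>lborel)"
    using c by (subst lborel_integral_real_affine[where c="-c" and t=x]) auto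
  also have "(\<integral>t. indicator {..x} (x - c * t) * (exp ((x - c * t)/c) * h (x - c * t)) \<partial>lborel)
      = (\<integral>t. exp (x/c) * (indicator {0..} t * exp (-t) * h (x - c * t)) \<partial>lborel)"
    by (simp only: exp_tail_substitution[OF c])
  also have "\<dots> = exp (x/c) * exp_average c h x"
    by (simp add: exp_average_def)
  finally show ?thesis using c by (simp add: exp_minus field_simps)
qed

lemma tail_integrable:
  fixes h :: "real \<Rightarrow> real"
  assumes "K-lipschitz_on UNIV h" and c: "0 < c"
  shows "integrable lborel (\<lambda>y. indicator {..x} y * (exp (y/c) * h y))"
proof -
  have "integrable lborel (\<lambda>t. indicator {..x} (x + (-c) * t) * (exp ((x + (-c) * t)/c) * h (x + (-c) * t)))"
    using integrable_mult_right[OF exp_average_integrable[OF assms(1), of x c], of "exp (x/c)"]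
    by (simp only: exp_tail_substitution[OF c] mult_minus_left add_uminus_conv_diff)
  then show ?thesis
    using c lborel_integrable_real_affine_iff[of "-c" "\<lambda>y. indicator {..x} y * (exp (y/c) * h y)" x] by simp
qed

lemma tail_integral_has_derivative:
  assumes "K-lipschitz_on UNIV h" and c: "0 < c"
  shows "((\<lambda>x. \<integral>y. indicator {..x} y * (exp (y/c) * h y) \<partial>lborel) has_real_derivative exp (x/c) * h x) (at x)"
proof -
  let ?q = "\<lambda>y. exp (y/c) * h y"
  let ?T = "\<lambda>x. \<integral>y. indicator {..x} y * ?q y \<partial>lborel"
  have cont: "continuous_on A ?q" for A
    using lipschitz_on_continuous_on[OF assms(1)] c
    by (auto intro!: continuous_intros continuous_on_subset[of UNIV h])
  \<comment> \<open>Cutting at \<open>x - 1\<close> leaves a constant plus an integral over a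
    compact interval, to which the fundamental theorem of calculus applies.\<close>
  have split: "?T u = ?T (x - 1) + (LBINT y=x-1..u. ?q y)" if "u \<in> {x-1..x+1}" for u
  proof -
    have "?T u - ?T (x - 1) = (\<integral>y. indicator {..u} y * ?q y - indicator {..x - 1} y * ?q y \<partial>lborel)"
      by (rule Bochner_Integration.integral_diff[symmetric]) (rule tail_integrable[OF assms])+
    also have "\<dots> = (LBINT y:{x-1<..u}. ?q y)"
      unfolding set_lebesgue_integral_def using that
      by (intro Bochner_Integration.integral_cong) (auto simp: indicator_def)
    also have "\<dots> = (LBINT y=x-1..u. ?q y)"
      using that by (simp add: interval_integral_Ioc)
    finally show ?thesis by simp
  qed
  have "((\<lambda>u. LBINT y=x-1..u. ?q y) has_vector_derivative ?q x) (at x within {x-1..x+1})"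
    by (rule interval_integral_FTC2) (use cont in auto)
  then have "((\<lambda>u. LBINT y=x-1..u. ?q y) has_real_derivative ?q x) (at x within {x-1..x+1})"
    by (simp add: has_real_derivative_iff_has_vector_derivative)
  then have "((\<lambda>u. LBINT y=x-1..u. ?q y) has_real_derivative ?q x) (at x)"
    by (subst (asm) at_within_Icc_at) auto
  then have "((\<lambda>u. ?T (x - 1) + (LBINT y=x-1..u. ?q y)) has_real_derivative ?q x) (at x)"
    by (auto intro!: derivative_eq_intros)
  moreover have "\<forall>\<^sub>F u in nhds x. ?T u = ?T (x - 1) + (LBINT y=x-1..u. ?q y)"
    by (rule eventually_mono[OF eventually_nhds_in_open[of "{x-1<..<x+1}"]])
      (auto intro!: split)
  ultimately show ?thesis
    by (rule DERIV_cong_ev[THEN iffD2, OF refl _ refl, rotated])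
qed

text \<open>Product rule: differentiating the prefactor reproduces the average divided by
  \<open>- c\<close>, and in the other term the exponentials cancel and leave
  \<open>h x / c\<close>.\<close>

lemma exp_average_has_derivative_pos:
  assumes "K-lipschitz_on UNIV h" and c: "0 < c"
  shows "(exp_average c h has_real_derivative (h x - exp_average c h x) / c) (at x)"
proof -
  have eq: "exp_average c h = (\<lambda>x. exp (-x/c) / c * (\<integral>y. indicator {..x} y * (exp (y/c) * h y) \<partial>lborel))"
    using exp_average_eq_tail_integral[OF c] by auto
  have "((\<lambda>x. exp (-x/c) / c) has_real_derivative - (exp (-x/c) / c) / c) (at x)"
    using c by (auto intro!: derivative_eq_intros)
  from DERIV_mult[OF this tail_integral_has_derivative[OF assms]]
  have "(exp_average c h has_real_derivative - (exp_average c h x / c) + exp (-x/c) * exp (x/c) * h x / c) (at x)"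
    unfolding eq by (simp add: mult_ac)
  also have "exp (-x/c) * exp (x/c) = 1" by (simp flip: exp_add)
  finally show ?thesis by (simp add: diff_divide_distrib)
qed

lemma exp_average_has_derivative:
  assumes "K-lipschitz_on UNIV h" and c: "c \<noteq> 0"
  shows "(exp_average c h has_real_derivative (h x - exp_average c h x) / c) (at x)"
proof (cases "0 < c")
  \<comment> \<open>Reflection about 0 reduces a negative \<open>c\<close> to the positive case; the
    inner derivative -1 restores the sign.\<close>
  case False
  then have c': "0 < - c" using c by simp
  have "K-lipschitz_on UNIV (\<lambda>y. h (-y))"
    using assms(1) unfolding lipschitz_on_real_iff by (metis abs_minus_commute minus_diff_eq minus_diff_minus)
  note D = exp_average_has_derivative_pos[OF this c', of "-x"]
  have "((\<lambda>x. exp_average (-c) (\<lambda>y. h (-y)) (-x)) has_real_derivative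
      (h (- (- x)) - exp_average (-c) (\<lambda>y. h (-y)) (-x)) / (-c) * (-1)) (at x)"
    by (rule DERIV_chain2[where f="exp_average (-c) (\<lambda>y. h (-y))" and g=uminus])
      (rule D, auto intro!: derivative_eq_intros)
  moreover have "exp_average c h = (\<lambda>x. exp_average (-c) (\<lambda>y. h (-y)) (-x))"
    using exp_average_reflect[of "-c" h] by auto
  ultimately show ?thesis by simp
qed (use exp_average_has_derivative_pos[OF assms(1)] in auto)

section \<open>Derivatives and Lipschitz constants of the Stein solution\<close>

lemma laplace_smoothing_lipschitz:
  assumes "K-lipschitz_on UNIV h"
  shows "K-lipschitz_on UNIV (laplace_smoothing b h)"
proof -
  note L = exp_average_lipschitz[OF assms, unfolded lipschitz_on_real_iff]
  have "\<bar>laplace_smoothing b h x - laplace_smoothing b h y\<bar> \<le> K * \<bar>x - y\<bar>" for x y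
  proof -
    have "\<bar>exp_average b h x - exp_average b h y\<bar> \<le> K * \<bar>x - y\<bar>"
      "\<bar>exp_average (-b) h x - exp_average (-b) h y\<bar> \<le> K * \<bar>x - y\<bar>"
      using L by blast+
    then show ?thesis unfolding laplace_smoothing_def by (simp add: abs_le_iff field_simps)
  qed
  then show ?thesis using L by (simp add: lipschitz_on_real_iff)
qed

lemma laplace_smoothing_bound:
  assumes "K-lipschitz_on UNIV h" and "\<And>x. \<bar>h x\<bar> \<le> C"
  shows "\<bar>laplace_smoothing b h x\<bar> \<le> C"
  using exp_average_bound[OF assms, of b x] exp_average_bound[OF assms, of "-b" x]
  unfolding laplace_smoothing_def by (simp add: abs_le_iff)

lemma laplace_smoothing_has_derivative:
  assumes "K-lipschitz_on UNIV h" and b: "0 < b"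
  shows "(laplace_smoothing b h has_real_derivative (exp_average (-b) h x - exp_average b h x) / (2 * b)) (at x)"
proof -
  have "((\<lambda>x. laplace_smoothing b h x) has_real_derivative (exp_average (-b) h x - exp_average b h x) / (2 * b)) (at x)"
    unfolding laplace_smoothing_def using b
    by (auto intro!: derivative_eq_intros exp_average_has_derivative[OF assms(1)] simp: field_simps)
  then show ?thesis by simp
qed

text \<open>This is the Stein equation \<open>g - b\<^sup>2 g'' = h\<close> of the Laplace distribution.\<close>

lemma laplace_smoothing_has_second_derivative:
  assumes "K-lipschitz_on UNIV h" and b: "0 < b"
  shows "((\<lambda>x. (exp_average (-b) h x - exp_average b h x) / (2 * b)) has_real_derivative
      (laplace_smoothing b h x - h x) / b\<^sup>2) (at x)"
  unfolding laplace_smoothing_def using b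
  by (auto intro!: derivative_eq_intros exp_average_has_derivative[OF assms(1)] simp: field_simps power2_eq_square)

text \<open>The derivative is a difference of two averages, each at most \<open>C\<close>, divided
  by \<open>2 * b\<close>. The resulting constant stays fixed for ramps of arbitrarily steep slope,
  which the Kolmogorov bound relies on.\<close>

lemma laplace_smoothing_lipschitz_of_bounded:
  assumes h: "K-lipschitz_on UNIV h" and b: "0 < b" and C: "\<And>x. \<bar>h x\<bar> \<le> C"
  shows "(C / b)-lipschitz_on UNIV (laplace_smoothing b h)"
proof (rule bounded_derivative_imp_lipschitz)
  let ?g' = "\<lambda>x. (exp_average (-b) h x - exp_average b h x) / (2 * b)"
  show "(laplace_smoothing b h has_derivative (\<lambda>y. ?g' x * y)) (at x within UNIV)" for x
    using laplace_smoothing_has_derivative[OF h b, of x] unfolding has_field_derivative_def .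
  show "onorm (\<lambda>y. ?g' x * y) \<le> C / b" for x
  proof (rule onorm_le)
    fix y
    have "\<bar>exp_average (-b) h x - exp_average b h x\<bar> \<le> 2 * C"
      using exp_average_bound[OF h C, of b x] exp_average_bound[OF h C, of "-b" x] by simp
    then have "\<bar>?g' x\<bar> \<le> C / b" using b by (simp add: field_simps abs_divide)
    then show "norm (?g' x * y) \<le> C / b * norm y"
      unfolding real_norm_def abs_mult by (rule mult_right_mono) simp
  qed
qed (use b order_trans[OF abs_ge_zero C] in auto)

section \<open>Integrals and distribution function of the Laplace law\<close>

lemma laplace_density_nonneg: "0 < b \<Longrightarrow> 0 \<le> laplace_density b x"
  by (simp add: laplace_density_def)

lemma laplace_density_measurable [measurable]: "laplace_density b \<in> borel_measurable borel"
  unfolding laplace_density_def by measurable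

text \<open>The density is split at 0. Scaling by \<open>c = b\<close> on the positive and
  \<open>c = - b\<close> on the negative half-line turns each part into a one-sided exponential
  average at 0.\<close>

lemma has_bochner_integral_laplace_density:
  assumes h: "K-lipschitz_on UNIV h" and b: "0 < b"
  shows "has_bochner_integral lborel (\<lambda>x. laplace_density b x * h x) (laplace_smoothing b h 0)"
proof -
  let ?f = "\<lambda>c x. indicator {0..} (x / c) * exp (- (x / c)) * h x / (2 * b)"
  have half: "has_bochner_integral lborel (?f c) (exp_average (-c) h 0 / 2)" if c: "c \<noteq> 0" "\<bar>c\<bar> = b" for c
  proof (subst lborel_has_bochner_integral_real_affine_iff[OF c(1), of _ _ 0])
    have "has_bochner_integral lborel (\<lambda>t. indicator {0..} t * exp (-t) * h (0 - (-c) * t) / (2 * b)) (exp_average (-c) h 0 / (2 * b))"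
      unfolding has_bochner_integral_iff
      using exp_average_integrable[OF h, of 0 "-c"]
      by (simp add: exp_average_def)
    then show "has_bochner_integral lborel (\<lambda>x. ?f c (0 + c * x)) ((exp_average (-c) h 0 / 2) /\<^sub>R \<bar>c\<bar>)"
      using c b by (simp add: field_simps)
  qed
  have "has_bochner_integral lborel (\<lambda>x. ?f b x + ?f (-b) x) (exp_average (-b) h 0 / 2 + exp_average (-(-b)) h 0 / 2)"
    by (intro has_bochner_integral_add half) (use b in auto)
  then have "has_bochner_integral lborel (\<lambda>x. ?f b x + ?f (-b) x) (laplace_smoothing b h 0)"
    by (simp add: laplace_smoothing_def add_divide_distrib add.commute)
  moreover have [measurable]: "h \<in> borel_measurable borel"
    by (rule lipschitz_borel_measurable[OF h])
  \<comment> \<open>At 0 both half-line indicators equal 1, so the sum counts that point twice; it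
    is a null set.\<close>
  moreover have "laplace_density b x * h x = ?f b x + ?f (-b) x" if "x \<noteq> 0" for x
    using b that by (cases "0 < x") (auto simp: laplace_density_def indicator_def divide_le_0_iff zero_le_divide_iff)
  then have "AE x in lborel. ?f b x + ?f (-b) x = laplace_density b x * h x"
    using AE_lborel_singleton[of 0] by (auto elim!: eventually_mono)
  ultimately show ?thesis
    by (elim has_bochner_integral_cong_AE[THEN iffD1, rotated 3]) measurable
qed

lemma
  assumes h: "K-lipschitz_on UNIV h" and b: "0 < b"
  shows integrable_laplace_lipschitz: "integrable (laplace_measure b) h"
    and integral_laplace_lipschitz: "(\<integral>x. h x \<partial>laplace_measure b) = laplace_smoothing b h 0"
proof -
  have [measurable]: "h \<in> borel_measurable borel"
    by (rule lipschitz_borel_measurable[OF h])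
  have "has_bochner_integral (laplace_measure b) h (laplace_smoothing b h 0)"
    unfolding laplace_measure_def
    using has_bochner_integral_laplace_density[OF h b] laplace_density_nonneg[OF b]
    by (intro has_bochner_integral_density) auto
  then show "integrable (laplace_measure b) h" "(\<integral>x. h x \<partial>laplace_measure b) = laplace_smoothing b h 0"
    by (auto simp: has_bochner_integral_iff)
qed

lemma sets_laplace_measure [simp, measurable_cong]: "sets (laplace_measure b) = sets borel"
  by (simp add: laplace_measure_def)

lemma space_laplace_measure [simp]: "space (laplace_measure b) = UNIV"
  by (simp add: laplace_measure_def)

lemma prob_space_laplace_measure:
  assumes b: "0 < b"
  shows "prob_space (laplace_measure b)"
proof
  \<comment> \<open>The total mass is the integral of the constant 1, a Lipschitz function to which
    the previous formula applies.\<close>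
  have L: "0-lipschitz_on UNIV (\<lambda>_::real. 1::real)" by (simp add: lipschitz_on_real_iff)
  have "has_bochner_integral lborel (laplace_density b) (laplace_smoothing b (\<lambda>_. 1) 0)"
    using has_bochner_integral_laplace_density[OF L b] by simp
  moreover have "laplace_smoothing b (\<lambda>_. 1) 0 = 1"
    by (simp add: laplace_smoothing_def exp_average_def integral_exp)
  ultimately have "(\<integral>\<^sup>+x. ennreal (laplace_density b x) \<partial>lborel) = 1"
    by (subst nn_integral_eq_integral) (auto simp: has_bochner_integral_iff laplace_density_nonneg[OF b])
  then show "emeasure (laplace_measure b) (space (laplace_measure b)) = 1"
    by (simp add: laplace_measure_def emeasure_density)
qed

text \<open>The density never exceeds its value \<open>1 / (2 * b)\<close> at 0.\<close>

lemma laplace_cdf_increment: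
  assumes b: "0 < b" and xy: "x \<le> y"
  shows "cdf_of (laplace_measure b) y \<le> cdf_of (laplace_measure b) x + (y - x) / (2 * b)"
proof -
  interpret prob_space "laplace_measure b" by (rule prob_space_laplace_measure[OF b])
  have "emeasure (laplace_measure b) {x<..y} = (\<integral>\<^sup>+t. ennreal (laplace_density b t) * indicator {x<..y} t \<partial>lborel)"
    unfolding laplace_measure_def by (rule emeasure_density) auto
  also have "\<dots> \<le> (\<integral>\<^sup>+t. ennreal (1 / (2 * b)) * indicator {x<..y} t \<partial>lborel)"
    using b by (intro nn_integral_mono mult_right_mono ennreal_leI) (auto simp: laplace_density_def field_simps)
  also have "\<dots> = ennreal ((y - x) / (2 * b))"
    using xy b by (simp add: nn_integral_cmult ennreal_mult'[symmetric])
  finally have "prob {x<..y} \<le> (y - x) / (2 * b)"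
    using xy b by (simp add: emeasure_eq_measure)
  moreover have "{..y} = {..x} \<union> {x<..y}" using xy by auto
  then have "prob {..y} = prob {..x} + prob {x<..y}"
    by (subst finite_measure_Union[symmetric]) auto
  ultimately show ?thesis by (simp add: cdf_of_def)
qed

subsection \<open>Quantile coupling\<close>

text \<open>Evaluated at a uniform \<open>u\<close>, the two quantile functions have laws \<mu> and
  \<nu> and differ by at most \<beta>. Hence the integrands compare pointwise on the unit
  interval.\<close>

lemma quantile_coupling_integral_mono:
  fixes \<mu> \<nu> :: "real measure" and \<phi> \<psi> :: "real \<Rightarrow> real"
  assumes \<mu>: "prob_space \<mu>" "sets \<mu> = sets borel" and \<nu>: "prob_space \<nu>" "sets \<nu> = sets borel"
    and close: "\<And>u. u \<in> {0<..<1} \<Longrightarrow> \<bar>gen_inverse \<mu> u - gen_inverse \<nu> u\<bar> \<le> \<beta>"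
    and le: "\<And>x y. \<bar>x - y\<bar> \<le> \<beta> \<Longrightarrow> \<phi> x \<le> \<psi> y"
    and int: "integrable \<mu> \<phi>" "integrable \<nu> \<psi>"
  shows "(\<integral>x. \<phi> x \<partial>\<mu>) \<le> (\<integral>x. \<psi> x \<partial>\<nu>)"
proof -
  let ?\<Omega> = "restrict_space lborel {0<..<1} :: real measure"
  interpret \<mu>: cdf_distribution \<mu>
    using \<mu> by (auto simp: cdf_distribution_def real_distribution_def real_distribution_axioms_def dest: sets_eq_imp_space_eq)
  interpret \<nu>: cdf_distribution \<nu>
    using \<nu> by (auto simp: cdf_distribution_def real_distribution_def real_distribution_axioms_def dest: sets_eq_imp_space_eq)
  \<comment> \<open>\<open>\<mu>.I\<close> is the same infimum as the generalized inverse, and it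
    maps Lebesgue measure on the unit interval to \<mu>; likewise for \<nu>.\<close>
  have inv: "gen_inverse \<mu> = \<mu>.I" "gen_inverse \<nu> = \<nu>.I"
    by (auto simp: gen_inverse_def cdf_of_def cdf_def)
  have [measurable]: "\<phi> \<in> borel_measurable borel" "\<psi> \<in> borel_measurable borel"
    using borel_measurable_integrable[OF int(1)] borel_measurable_integrable[OF int(2)] \<mu>(2) \<nu>(2)
    by (auto cong: measurable_cong_sets)
  have m: "\<mu>.I \<in> measurable ?\<Omega> borel" "\<nu>.I \<in> measurable ?\<Omega> borel"
    by (auto intro!: \<mu>.measurable_CI \<nu>.measurable_CI simp: measurable_cong_sets[OF sets_restrict_space_cong[OF sets_lborel] refl])
  have "integrable (distr ?\<Omega> borel \<mu>.I) \<phi>" "integrable (distr ?\<Omega> borel \<nu>.I) \<psi>"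
    using int by (simp_all only: \<mu>.distr_I_eq_M \<nu>.distr_I_eq_M)
  then have i: "integrable ?\<Omega> (\<lambda>u. \<phi> (\<mu>.I u))" "integrable ?\<Omega> (\<lambda>u. \<psi> (\<nu>.I u))"
    using m by (simp_all add: integrable_distr_eq)
  have "(\<integral>x. \<phi> x \<partial>\<mu>) = (\<integral>x. \<phi> x \<partial>distr ?\<Omega> borel \<mu>.I)"
    by (simp only: \<mu>.distr_I_eq_M)
  also have "\<dots> = (\<integral>u. \<phi> (\<mu>.I u) \<partial>?\<Omega>)"
    by (rule integral_distr) (use m in auto)
  also have "\<dots> \<le> (\<integral>u. \<psi> (\<nu>.I u) \<partial>?\<Omega>)"
    using le close[unfolded inv] by (intro integral_mono i) (auto simp: space_restrict_space)
  also have "\<dots> = (\<integral>x. \<psi> x \<partial>distr ?\<Omega> borel \<nu>.I)"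
    by (rule integral_distr[symmetric]) (use m in auto)
  also have "\<dots> = (\<integral>x. \<psi> x \<partial>\<nu>)"
    by (simp only: \<nu>.distr_I_eq_M)
  finally show ?thesis .
qed

subsection \<open>Geometric sums\<close>

text \<open>Independence makes the joint law a product, so by Fubini the new summand can be
  integrated first while the past \<open>s\<close> stays frozen.\<close>

lemma (in prob_space)
  fixes F :: "real \<Rightarrow> real \<Rightarrow> real"
  assumes indep: "indep_var borel A borel B"
    and F [measurable]: "case_prod F \<in> borel_measurable (borel \<Otimes>\<^sub>M borel)"
    and int: "integrable M (\<lambda>\<omega>. F (A \<omega>) (B \<omega>))"
  shows indep_var_integrable_inner: "integrable (distr M borel B) (\<lambda>s. \<integral>x. F x s \<partial>distr M borel A)"
    and indep_var_integral_iterated: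
      "(\<integral>\<omega>. F (A \<omega>) (B \<omega>) \<partial>M) = (\<integral>s. (\<integral>x. F x s \<partial>distr M borel A) \<partial>distr M borel B)"
proof -
  have [measurable]: "A \<in> borel_measurable M" "B \<in> borel_measurable M"
    and eq: "distr M borel A \<Otimes>\<^sub>M distr M borel B = distr M (borel \<Otimes>\<^sub>M borel) (\<lambda>\<omega>. (A \<omega>, B \<omega>))"
    using indep unfolding indep_var_distribution_eq by auto
  interpret A: prob_space "distr M borel A" by (rule prob_space_distr) simp
  interpret B: prob_space "distr M borel B" by (rule prob_space_distr) simp
  interpret AB: pair_sigma_finite "distr M borel A" "distr M borel B" ..
  have i: "integrable (distr M borel A \<Otimes>\<^sub>M distr M borel B) (case_prod F)"
    unfolding eq using int by (simp add: integrable_distr_eq)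
  show "integrable (distr M borel B) (\<lambda>s. \<integral>x. F x s \<partial>distr M borel A)"
    by (rule AB.integrable_snd[OF i])
  show "(\<integral>\<omega>. F (A \<omega>) (B \<omega>) \<partial>M) = (\<integral>s. (\<integral>x. F x s \<partial>distr M borel A) \<partial>distr M borel B)"
    unfolding AB.integral_snd[OF i] unfolding eq by (simp add: integral_distr)
qed

locale centered_sequence = prob_space M for M :: "'a measure" +
  fixes X :: "nat \<Rightarrow> 'a \<Rightarrow> real" and \<sigma> :: real
  assumes X_meas [measurable]: "\<And>i. i \<ge> 1 \<Longrightarrow> X i \<in> borel_measurable M"
    and indep_X: "indep_vars (\<lambda>_. borel) X {1..}"
    and int_X: "\<And>i. i \<ge> 1 \<Longrightarrow> integrable M (X i)"
    and int_X2: "\<And>i. i \<ge> 1 \<Longrightarrow> integrable M (\<lambda>\<omega>. (X i \<omega>)\<^sup>2)"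
    and mean_X: "\<And>i. i \<ge> 1 \<Longrightarrow> (\<integral>\<omega>. X i \<omega> \<partial>M) = 0"
    and var_X: "\<And>i. i \<ge> 1 \<Longrightarrow> (\<integral>\<omega>. (X i \<omega>)\<^sup>2 \<partial>M) = \<sigma>\<^sup>2"
    and sigma_pos: "\<sigma> > 0"
begin

abbreviation partial_sum :: "nat \<Rightarrow> 'a \<Rightarrow> real" where
  "partial_sum n \<omega> \<equiv> \<Sum>i=1..n. X i \<omega>"

abbreviation law :: "nat \<Rightarrow> real measure" where
  "law i \<equiv> distr M borel (X i)"

lemma prob_space_law: "i \<ge> 1 \<Longrightarrow> prob_space (law i)"
  by (rule prob_space_distr) simp

lemma
  assumes i: "i \<ge> 1"
  shows integrable_law_id: "integrable (law i) (\<lambda>x. x)"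
    and integral_law_id: "(\<integral>x. x \<partial>law i) = 0"
    and integrable_law_square: "integrable (law i) (\<lambda>x. x\<^sup>2)"
    and integral_law_square: "(\<integral>x. x\<^sup>2 \<partial>law i) = \<sigma>\<^sup>2"
  using X_meas[OF i] int_X[OF i] mean_X[OF i] int_X2[OF i] var_X[OF i]
  by (simp_all add: integrable_distr_eq integral_distr)

lemma expectation_abs_X_le:
  assumes i: "i \<ge> 1"
  shows "(\<integral>\<omega>. \<bar>X i \<omega>\<bar> \<partial>M) \<le> \<sigma>"
proof -
  have "(\<integral>\<omega>. \<bar>X i \<omega>\<bar> \<partial>M) \<le> (\<integral>\<omega>. (X i \<omega>)\<^sup>2 / (2 * \<sigma>) + \<sigma> / 2 \<partial>M)"
  proof (rule integral_mono)
    fix \<omega>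
    \<comment> \<open>Completing the square bounds the absolute value by an expression whose mean is
      exactly \<sigma>.\<close>
    have "0 \<le> (\<bar>X i \<omega>\<bar> - \<sigma>)\<^sup>2" by simp
    then have "2 * \<bar>X i \<omega>\<bar> * \<sigma> \<le> (X i \<omega>)\<^sup>2 + \<sigma>\<^sup>2" by (simp add: power2_diff)
    then show "\<bar>X i \<omega>\<bar> \<le> (X i \<omega>)\<^sup>2 / (2 * \<sigma>) + \<sigma> / 2"
      using sigma_pos by (simp add: field_simps power2_eq_square)
  qed (use int_X[OF i] int_X2[OF i] in auto)
  also have "\<dots> = \<sigma>"
    using int_X2[OF i] var_X[OF i] sigma_pos by (simp add: prob_space power2_eq_square)
  finally show ?thesis .
qed

lemma partial_sum_measurable [measurable]: "partial_sum n \<in> borel_measurable M"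
  by (intro borel_measurable_sum) simp

lemma integrable_partial_sum: "integrable M (partial_sum n)"
  by (intro Bochner_Integration.integrable_sum int_X) simp

lemma expectation_abs_partial_sum_le: "(\<integral>\<omega>. \<bar>partial_sum n \<omega>\<bar> \<partial>M) \<le> real n * \<sigma>"
proof -
  have "(\<integral>\<omega>. \<bar>partial_sum n \<omega>\<bar> \<partial>M) \<le> (\<integral>\<omega>. (\<Sum>i=1..n. \<bar>X i \<omega>\<bar>) \<partial>M)"
    by (intro integral_mono integrable_abs integrable_partial_sum Bochner_Integration.integrable_sum int_X sum_abs) simp
  also have "\<dots> = (\<Sum>i=1..n. \<integral>\<omega>. \<bar>X i \<omega>\<bar> \<partial>M)"
    by (intro Bochner_Integration.integral_sum integrable_abs int_X) simp
  also have "\<dots> \<le> (\<Sum>i=1..n. \<sigma>)"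
    by (intro sum_mono expectation_abs_X_le) simp
  finally show ?thesis by simp
qed

lemma indep_X_partial_sum: "indep_var borel (X (Suc n)) borel (partial_sum n)"
  by (rule indep_vars_sum) (auto intro: indep_vars_subset[OF indep_X])

end

section \<open>Expectations of functions of the geometric sum\<close>

locale geometric_compound = centered_sequence M X \<sigma>
  for M :: "'a measure" and X :: "nat \<Rightarrow> 'a \<Rightarrow> real" and \<sigma> :: real +
  fixes p :: real and N :: "'a \<Rightarrow> nat"
  assumes p: "p \<in> {0<..<1}"
    and geom: "geometric_rv M p N"
    and indep_N: "indep_of_seq M N X"
begin

lemma N_measurable [measurable]: "N \<in> measurable M (count_space UNIV)"
  using geom by (simp add: geometric_rv_def)

lemma prob_N: "prob {\<omega> \<in> space M. N \<omega> = Suc n} = p * (1 - p) ^ n"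
  using geom by (auto simp: geometric_rv_def)

lemma W_measurable [measurable]: "compound_W p N X \<in> borel_measurable M"
proof -
  have "(\<lambda>\<omega>. sqrt p * partial_sum (N \<omega>) \<omega>) \<in> borel_measurable M"
    by (intro measurable_compose_countable[where f="\<lambda>n \<omega>. sqrt p * partial_sum n \<omega>" and g=N]) auto
  then show ?thesis by (simp add: compound_W_def[abs_def])
qed

lemma geometric_weights_sums: "(\<lambda>n. p * (1 - p) ^ n * c) sums c"
  using sums_mult[OF geometric_sums[of "1 - p"], of "p * c"] p by (simp add: mult_ac)

text \<open>The probabilities prescribed for \<open>k \<ge> 1\<close> already add up to 1.\<close>

lemma AE_N_pos: "AE \<omega> in M. N \<omega> \<noteq> 0"
proof -
  have "(\<lambda>n. prob {\<omega> \<in> space M. N \<omega> = Suc n}) sums prob (\<Union>n. {\<omega> \<in> space M. N \<omega> = Suc n})"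
    by (rule finite_measure_UNION) (auto simp: disjoint_family_on_def)
  then have "prob (\<Union>n. {\<omega> \<in> space M. N \<omega> = Suc n}) = 1"
    unfolding prob_N using geometric_weights_sums[of 1] by (auto dest: sums_unique2)
  also have "(\<Union>n. {\<omega> \<in> space M. N \<omega> = Suc n}) = {\<omega> \<in> space M. N \<omega> \<noteq> 0}"
    by (auto simp: not0_implies_Suc)
  finally show ?thesis by (subst (asm) prob_eq_1) (auto elim: AE_mp)
qed

text \<open>In the family of \<open>indep_of_seq\<close> the variable \<open>N\<close> sits at index
  0, and the sum groups the indices \<open>1..n\<close> of the same family.\<close>

lemma indep_N_partial_sum: "indep_var borel (\<lambda>\<omega>. real (N \<omega>)) borel (partial_sum n)"
proof -
  have "indep_vars (\<lambda>_. borel) (\<lambda>i \<omega>. if i = 0 then real (N \<omega>) else X i \<omega>) (insert 0 {1..n})"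
    using indep_N unfolding indep_of_seq_def by (rule indep_vars_subset) auto
  from indep_vars_sum[OF _ _ this]
  have "indep_var borel (\<lambda>\<omega>. real (N \<omega>)) borel (\<lambda>\<omega>. \<Sum>i=1..n. if i = 0 then real (N \<omega>) else X i \<omega>)"
    by simp
  also have "(\<lambda>\<omega>. \<Sum>i=1..n. if i = 0 then real (N \<omega>) else X i \<omega>) = partial_sum n"
    by (intro ext sum.cong) auto
  finally show ?thesis .
qed

text \<open>The event that \<open>N\<close> equals \<open>m\<close> is determined by
  \<open>real (N \<omega>)\<close>, hence independent of the partial sum, and its indicator factors
  out.\<close>

lemma restrict_N:
  fixes f' :: "real \<Rightarrow> real"
  assumes [measurable]: "f' \<in> borel_measurable borel" and int: "integrable M (\<lambda>\<omega>. f' (partial_sum n \<omega>))"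
  shows "integrable M (\<lambda>\<omega>. indicator {\<omega> \<in> space M. N \<omega> = m} \<omega> * f' (partial_sum n \<omega>))"
    and "(\<integral>\<omega>. indicator {\<omega> \<in> space M. N \<omega> = m} \<omega> * f' (partial_sum n \<omega>) \<partial>M)
      = prob {\<omega> \<in> space M. N \<omega> = m} * (\<integral>\<omega>. f' (partial_sum n \<omega>) \<partial>M)"
proof -
  let ?i = "\<lambda>\<omega>. indicator {real m} (real (N \<omega>)) :: real"
  have "indep_var borel (indicator {real m} \<circ> (\<lambda>\<omega>. real (N \<omega>))) borel (f' \<circ> partial_sum n)"
    by (rule indep_var_compose[OF indep_N_partial_sum]) auto
  then have i: "indep_var borel ?i borel (\<lambda>\<omega>. f' (partial_sum n \<omega>))"
    by (simp add: comp_def)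
  have c: "indicator {\<omega> \<in> space M. N \<omega> = m} \<omega> * y = ?i \<omega> * y" if "\<omega> \<in> space M" for \<omega> and y :: real
    using that by (auto simp: indicator_def)
  have int_i: "integrable M ?i"
    by (rule integrable_const_bound[where B=1]) auto
  show "integrable M (\<lambda>\<omega>. indicator {\<omega> \<in> space M. N \<omega> = m} \<omega> * f' (partial_sum n \<omega>))"
    using indep_var_integrable[OF i int_i int] by (subst Bochner_Integration.integrable_cong[OF refl c]) auto
  have "(\<integral>\<omega>. ?i \<omega> \<partial>M) = (\<integral>\<omega>. indicator {\<omega> \<in> space M. N \<omega> = m} \<omega> \<partial>M)"
    by (intro Bochner_Integration.integral_cong) (auto simp: indicator_def)
  then have "(\<integral>\<omega>. ?i \<omega> \<partial>M) = prob {\<omega> \<in> space M. N \<omega> = m}"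
    by simp
  then show "(\<integral>\<omega>. indicator {\<omega> \<in> space M. N \<omega> = m} \<omega> * f' (partial_sum n \<omega>) \<partial>M)
      = prob {\<omega> \<in> space M. N \<omega> = m} * (\<integral>\<omega>. f' (partial_sum n \<omega>) \<partial>M)"
    using indep_var_lebesgue_integral[OF i int_i int] by (subst Bochner_Integration.integral_cong[OF refl c]) auto
qed

section \<open>Test functions of at most linear growth\<close>

context
  fixes f :: "real \<Rightarrow> real" and C :: real
  assumes f_meas [measurable]: "f \<in> borel_measurable borel"
    and growth: "\<And>x. \<bar>f x\<bar> \<le> C * (1 + \<bar>x\<bar>)"
begin

lemma growth_const_nonneg: "0 \<le> C"
  using order_trans[OF abs_ge_zero growth[of 0]] by simp

lemma integrable_growth:
  assumes "integrable M Y" "Y \<in> borel_measurable M"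
  shows "integrable M (\<lambda>\<omega>. f (Y \<omega>))"
proof (rule Bochner_Integration.integrable_bound)
  show "integrable M (\<lambda>\<omega>. C * (1 + \<bar>Y \<omega>\<bar>))"
    using assms(1) by auto
  show "AE \<omega> in M. norm (f (Y \<omega>)) \<le> norm (C * (1 + \<bar>Y \<omega>\<bar>))"
    by (intro AE_I2) (metis abs_ge_self growth order_trans real_norm_def)
qed (use assms(2) in measurable)

lemma integrable_growth_partial_sum: "integrable M (\<lambda>\<omega>. f (sqrt p * partial_sum n \<omega>))"
  by (intro integrable_growth integrable_mult_right integrable_partial_sum) measurable

lemma expectation_growth_partial_sum:
  "(\<integral>\<omega>. \<bar>f (sqrt p * partial_sum n \<omega>)\<bar> \<partial>M) \<le> C * (1 + \<sigma>) * real (Suc n)"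
proof -
  have "(\<integral>\<omega>. \<bar>f (sqrt p * partial_sum n \<omega>)\<bar> \<partial>M) \<le> (\<integral>\<omega>. C * (1 + \<bar>partial_sum n \<omega>\<bar>) \<partial>M)"
  proof (rule integral_mono)
    fix \<omega>
    have "\<bar>sqrt p * partial_sum n \<omega>\<bar> \<le> 1 * \<bar>partial_sum n \<omega>\<bar>"
      unfolding abs_mult using p by (intro mult_right_mono) auto
    then have "C * (1 + \<bar>sqrt p * partial_sum n \<omega>\<bar>) \<le> C * (1 + \<bar>partial_sum n \<omega>\<bar>)"
      using growth_const_nonneg by (intro mult_left_mono) auto
    then show "\<bar>f (sqrt p * partial_sum n \<omega>)\<bar> \<le> C * (1 + \<bar>partial_sum n \<omega>\<bar>)"
      using growth order_trans by blast
  qed (use integrable_partial_sum integrable_growth_partial_sum in auto)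
  also have "\<dots> = C * (1 + (\<integral>\<omega>. \<bar>partial_sum n \<omega>\<bar> \<partial>M))"
    using integrable_partial_sum by (simp add: prob_space)
  also have "\<dots> \<le> C * (1 + real n * \<sigma>)"
    using expectation_abs_partial_sum_le growth_const_nonneg by (intro mult_left_mono) auto
  also have "\<dots> \<le> C * ((1 + \<sigma>) * real (Suc n))"
    using growth_const_nonneg sigma_pos by (intro mult_left_mono) (auto simp: algebra_simps)
  finally show ?thesis by (simp add: mult.assoc)
qed

text \<open>Expectations grow at most linearly in the number of summands, and geometric weights sum
  a linear factor. The double successor appears because the term of weight
  \<open>(1 - p) ^ n\<close> involves \<open>n + 1\<close> summands.\<close>

lemma summable_growth_bound: "summable (\<lambda>n. (1 - p) ^ n * (C * (1 + \<sigma>) * real (Suc (Suc n))))"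
proof -
  have "summable (\<lambda>n. real (Suc n) * (1 - p) ^ n)"
    using geometric_deriv_sums[of "1 - p"] p by (auto simp: sums_iff)
  from summable_mult[OF this, of "C * (1 + \<sigma>) * 2"]
  have "summable (\<lambda>n. C * (1 + \<sigma>) * 2 * (real (Suc n) * (1 - p) ^ n))" .
  then show ?thesis
  proof (rule summable_comparison_test')
    fix n :: nat
    have "C * (1 + \<sigma>) * real (Suc (Suc n)) \<le> C * (1 + \<sigma>) * (2 * real (Suc n))"
      using growth_const_nonneg sigma_pos by (intro mult_left_mono) auto
    then have "(1 - p) ^ n * (C * (1 + \<sigma>) * real (Suc (Suc n))) \<le> (1 - p) ^ n * (C * (1 + \<sigma>) * (2 * real (Suc n)))"
      by (rule mult_left_mono) (use p in auto)
    moreover have "0 \<le> (1 - p) ^ n * (C * (1 + \<sigma>) * real (Suc (Suc n)))"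
      using growth_const_nonneg sigma_pos p by auto
    ultimately show "norm ((1 - p) ^ n * (C * (1 + \<sigma>) * real (Suc (Suc n)))) \<le> C * (1 + \<sigma>) * 2 * (real (Suc n) * (1 - p) ^ n)"
      by (simp only: real_norm_def abs_of_nonneg mult_ac)
  qed
qed

text \<open>Decomposition by the value of \<open>N\<close>. Summability of the expected norms
  permits exchanging the sum with the expectation.\<close>

lemma expectation_W_sums:
  "(\<lambda>n. p * (1 - p) ^ n * (\<integral>\<omega>. f (sqrt p * partial_sum (Suc n) \<omega>) \<partial>M)) sums (\<integral>\<omega>. f (compound_W p N X \<omega>) \<partial>M)"
proof -
  define F where "F n \<omega> = indicator {\<omega> \<in> space M. N \<omega> = Suc n} \<omega> * f (sqrt p * partial_sum (Suc n) \<omega>)" for n \<omega>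
  have int: "integrable M (F n)" for n
    unfolding F_def by (rule restrict_N(1)[OF _ integrable_growth_partial_sum]) measurable
  have E: "(\<integral>\<omega>. F n \<omega> \<partial>M) = p * (1 - p) ^ n * (\<integral>\<omega>. f (sqrt p * partial_sum (Suc n) \<omega>) \<partial>M)" for n
    unfolding F_def by (subst restrict_N(2)[OF _ integrable_growth_partial_sum]) (simp_all only: prob_N, measurable)
  have E_norm: "(\<integral>\<omega>. norm (F n \<omega>) \<partial>M) = p * (1 - p) ^ n * (\<integral>\<omega>. \<bar>f (sqrt p * partial_sum (Suc n) \<omega>)\<bar> \<partial>M)" for n
    unfolding F_def real_norm_def abs_mult abs_indicator
    by (subst restrict_N(2)[where f'="\<lambda>x. \<bar>f (sqrt p * x)\<bar>", OF _ integrable_abs[OF integrable_growth_partial_sum]])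
      (simp_all only: prob_N, measurable)
  have single: "(\<lambda>n. F n \<omega>) sums f (compound_W p N X \<omega>)" and summable: "summable (\<lambda>n. norm (F n \<omega>))"
    if "N \<omega> \<noteq> 0" "\<omega> \<in> space M" for \<omega>
  proof -
    \<comment> \<open>For a fixed outcome exactly one index contributes, so convergence is trivial
      pointwise.\<close>
    obtain m where m: "N \<omega> = Suc m" using \<open>N \<omega> \<noteq> 0\<close> not0_implies_Suc by blast
    have F: "(\<lambda>n. F n \<omega>) = (\<lambda>n. if n = m then f (sqrt p * partial_sum (Suc n) \<omega>) else 0)"
      using that m by (auto simp: F_def)
    show "(\<lambda>n. F n \<omega>) sums f (compound_W p N X \<omega>)"
      unfolding F using sums_single[of m "\<lambda>n. f (sqrt p * partial_sum (Suc n) \<omega>)"] by (simp add: compound_W_def m)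
    show "summable (\<lambda>n. norm (F n \<omega>))"
      by (rule summable_finite[of "{m}"]) (use fun_cong[OF F] in auto)
  qed
  have AE_summable: "AE \<omega> in M. summable (\<lambda>n. norm (F n \<omega>))"
    using AE_N_pos AE_space by eventually_elim (rule summable)
  have AE_eq: "AE \<omega> in M. (\<Sum>n. F n \<omega>) = f (compound_W p N X \<omega>)"
    using AE_N_pos AE_space by eventually_elim (rule sums_unique[OF single, symmetric])
  have norms: "summable (\<lambda>n. \<integral>\<omega>. norm (F n \<omega>) \<partial>M)"
  proof (rule summable_comparison_test'[OF summable_growth_bound])
    fix n
    have "p * (1 - p) ^ n * (\<integral>\<omega>. \<bar>f (sqrt p * partial_sum (Suc n) \<omega>)\<bar> \<partial>M) \<le> 1 * (1 - p) ^ n * (C * (1 + \<sigma>) * real (Suc (Suc n)))"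
      using p by (intro mult_mono expectation_growth_partial_sum) auto
    then show "norm (\<integral>\<omega>. norm (F n \<omega>) \<partial>M) \<le> (1 - p) ^ n * (C * (1 + \<sigma>) * real (Suc (Suc n)))"
      unfolding E_norm using p by (simp add: abs_mult)
  qed
  have m [measurable]: "F n \<in> borel_measurable M" for n
    by (rule borel_measurable_integrable[OF int])
  have "(\<integral>\<omega>. (\<Sum>n. F n \<omega>) \<partial>M) = (\<integral>\<omega>. f (compound_W p N X \<omega>) \<partial>M)"
    by (rule integral_cong_AE[OF _ _ AE_eq]) measurable
  then show "(\<lambda>n. p * (1 - p) ^ n * (\<integral>\<omega>. f (sqrt p * partial_sum (Suc n) \<omega>) \<partial>M)) sums (\<integral>\<omega>. f (compound_W p N X \<omega>) \<partial>M)"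
    using sums_integral[OF int AE_summable norms] by (simp only: E)
qed

text \<open>This removes the boundary term at infinity in the summation by parts.\<close>

lemma discounted_expectation_tendsto_0:
  "(\<lambda>n. (1 - p) ^ n * (\<integral>\<omega>. f (sqrt p * partial_sum n \<omega>) \<partial>M)) \<longlonglongrightarrow> 0"
proof (rule Lim_null_comparison)
  show "(\<lambda>n. (1 - p) ^ n * (C * (1 + \<sigma>) * real (Suc (Suc n)))) \<longlonglongrightarrow> 0"
    by (rule summable_LIMSEQ_zero[OF summable_growth_bound])
  have "\<bar>\<integral>\<omega>. f (sqrt p * partial_sum n \<omega>) \<partial>M\<bar> \<le> C * (1 + \<sigma>) * real (Suc (Suc n))" for n
  proof -
    have "\<bar>\<integral>\<omega>. f (sqrt p * partial_sum n \<omega>) \<partial>M\<bar> \<le> C * (1 + \<sigma>) * real (Suc n)"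
      using integral_abs_bound expectation_growth_partial_sum by (rule order_trans)
    also have "\<dots> \<le> C * (1 + \<sigma>) * real (Suc (Suc n))"
      using growth_const_nonneg sigma_pos by (intro mult_left_mono) auto
    finally show ?thesis .
  qed
  then show "\<forall>\<^sub>F n in sequentially. norm ((1 - p) ^ n * (\<integral>\<omega>. f (sqrt p * partial_sum n \<omega>) \<partial>M)) \<le> (1 - p) ^ n * (C * (1 + \<sigma>) * real (Suc (Suc n)))"
    using p by (intro always_eventually allI) (simp only: real_norm_def abs_mult, intro mult_mono, auto)
qed

end

text \<open>Writing \<open>e n\<close> and \<open>\<kappa> n\<close> for the expectations of \<open>g\<close> and \<open>k\<close> at \<open>sqrt p * partial_sum n\<close>, the
  hypothesis \<open>step\<close> bounds \<open>p (\<kappa> (n+1) - e (n+1)) + e (n+1) - e n\<close> for every \<open>n\<close>; weighted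
  by \<open>(1 - p) ^ n\<close>, the terms in \<open>e\<close> telescope to \<open>- e 0 = - g 0\<close>.\<close>

lemma expectation_W_le:
  assumes k [measurable]: "k \<in> borel_measurable borel" and k_growth: "\<And>x. \<bar>k x\<bar> \<le> C * (1 + \<bar>x\<bar>)"
    and g [measurable]: "g \<in> borel_measurable borel" and g_growth: "\<And>x. \<bar>g x\<bar> \<le> C' * (1 + \<bar>x\<bar>)"
    and step: "\<And>i s. i \<ge> 1 \<Longrightarrow>
      (\<integral>x. p * (k (sqrt p * (s + x)) - g (sqrt p * (s + x))) + g (sqrt p * (s + x)) - g (sqrt p * s) \<partial>law i) \<le> p * D"
  shows "(\<integral>\<omega>. k (compound_W p N X \<omega>) \<partial>M) \<le> g 0 + D"
proof -
  define e where "e n = (\<integral>\<omega>. g (sqrt p * partial_sum n \<omega>) \<partial>M)" for n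
  define \<kappa> where "\<kappa> n = (\<integral>\<omega>. k (sqrt p * partial_sum n \<omega>) \<partial>M)" for n
  have ig: "integrable M (\<lambda>\<omega>. g (sqrt p * partial_sum n \<omega>))"
    and ik: "integrable M (\<lambda>\<omega>. k (sqrt p * partial_sum n \<omega>))" for n
    using integrable_growth_partial_sum[OF g g_growth] integrable_growth_partial_sum[OF k k_growth] by auto
  \<comment> \<open>The new summand is independent of the past, so the hypothesis
    \<open>step\<close> is applied for each fixed value \<open>s\<close> of the partial sum and then
    averaged.\<close>
  have e_step: "p * (\<kappa> (Suc n) - e (Suc n)) + e (Suc n) - e n \<le> p * D" for n
  proof -
    let ?F = "\<lambda>x s. p * (k (sqrt p * (s + x)) - g (sqrt p * (s + x))) + g (sqrt p * (s + x)) - g (sqrt p * s)"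
    have F: "?F (X (Suc n) \<omega>) (partial_sum n \<omega>) =
        p * (k (sqrt p * partial_sum (Suc n) \<omega>) - g (sqrt p * partial_sum (Suc n) \<omega>))
        + g (sqrt p * partial_sum (Suc n) \<omega>) - g (sqrt p * partial_sum n \<omega>)" for \<omega>
      by simp
    have iF: "integrable M (\<lambda>\<omega>. ?F (X (Suc n) \<omega>) (partial_sum n \<omega>))"
      unfolding F by (intro Bochner_Integration.integrable_add Bochner_Integration.integrable_diff integrable_mult_right ig ik)
    have mF: "case_prod ?F \<in> borel_measurable (borel \<Otimes>\<^sub>M borel)"
      by measurable
    interpret S: prob_space "distr M borel (partial_sum n)"
      by (rule prob_space_distr) measurable
    have "p * (\<kappa> (Suc n) - e (Suc n)) + e (Suc n) - e n = (\<integral>\<omega>. ?F (X (Suc n) \<omega>) (partial_sum n \<omega>) \<partial>M)"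
      unfolding F \<kappa>_def e_def using ig ik by (simp del: sum.cl_ivl_Suc)
    also have "\<dots> = (\<integral>s. (\<integral>x. ?F x s \<partial>law (Suc n)) \<partial>distr M borel (partial_sum n))"
      by (rule indep_var_integral_iterated[OF indep_X_partial_sum mF iF])
    also have "\<dots> \<le> p * D"
      by (intro S.integral_le_const indep_var_integrable_inner[OF indep_X_partial_sum mF iF] AE_I2 step) simp
    finally show ?thesis .
  qed
  have "(\<lambda>n. p * (1 - p) ^ n * \<kappa> (Suc n) + ((1 - p) ^ Suc n * e (Suc n) - (1 - p) ^ n * e n))
      sums ((\<integral>\<omega>. k (compound_W p N X \<omega>) \<partial>M) + (0 - (1 - p) ^ 0 * e 0))"
    unfolding \<kappa>_def
    by (intro sums_add expectation_W_sums[OF k k_growth] telescope_sums)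
      (use discounted_expectation_tendsto_0[OF g g_growth] in \<open>simp add: e_def\<close>)
  \<comment> \<open>Writing \<open>(1 - p) ^ Suc n\<close> as
    \<open>(1 - p) ^ n - p * (1 - p) ^ n\<close> shows that the summand is
    \<open>(1 - p) ^ n\<close> times the left side of \<open>e_step\<close>.\<close>
  moreover have "p * (1 - p) ^ n * \<kappa> (Suc n) + ((1 - p) ^ Suc n * e (Suc n) - (1 - p) ^ n * e n) \<le> p * (1 - p) ^ n * D" for n
  proof -
    have "(1 - p) ^ n * (p * (\<kappa> (Suc n) - e (Suc n)) + e (Suc n) - e n) \<le> (1 - p) ^ n * (p * D)"
      using p by (intro mult_left_mono e_step) auto
    then show ?thesis by (simp add: algebra_simps)
  qed
  ultimately have "(\<integral>\<omega>. k (compound_W p N X \<omega>) \<partial>M) + (0 - (1 - p) ^ 0 * e 0) \<le> D"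
    by (intro sums_le[OF _ _ geometric_weights_sums[of D]])
  moreover have "e 0 = g 0" by (simp add: e_def prob_space)
  ultimately show ?thesis by simp
qed

end

subsection \<open>Bounds by Stein's method\<close>

text \<open>The second derivative of the gap \<open>?u\<close> is
  \<open>K * r - (f'' r - f'' 0)\<close>, which is nonnegative; since \<open>?u\<close> and
  \<open>?u'\<close> vanish at 0, monotonicity carries the sign back twice. A Lipschitz bound on
  \<open>f''\<close> thus replaces a third derivative.\<close>

lemma taylor_second_order_upper:
  fixes f f' f'' :: "real \<Rightarrow> real"
  assumes f': "\<And>t. (f has_real_derivative f' t) (at t)"
    and f'': "\<And>t. (f' has_real_derivative f'' t) (at t)"
    and lip: "\<And>t. 0 \<le> t \<Longrightarrow> f'' t - f'' 0 \<le> K * t"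
    and x: "0 \<le> x"
  shows "f x - f 0 - f' 0 * x - f'' 0 / 2 * x\<^sup>2 \<le> K * x ^ 3 / 6"
proof -
  let ?u = "\<lambda>t. K * t ^ 3 / 6 - (f t - f 0 - f' 0 * t - f'' 0 / 2 * t\<^sup>2)"
  let ?u' = "\<lambda>t. K * t\<^sup>2 / 2 - (f' t - f' 0 - f'' 0 * t)"
  have u'_nonneg: "0 \<le> ?u' t" if "0 \<le> t" for t
  proof -
    have "?u' 0 \<le> ?u' t"
    proof (rule DERIV_nonneg_imp_nondecreasing[OF that])
      fix r assume "0 \<le> r" "r \<le> t"
      moreover have "(?u' has_real_derivative K * r - (f'' r - f'' 0)) (at r)"
        by (auto intro!: derivative_eq_intros f'')
      ultimately show "\<exists>y. (?u' has_real_derivative y) (at r) \<and> 0 \<le> y"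
        using lip[of r] by (intro exI[of _ "K * r - (f'' r - f'' 0)"]) auto
    qed
    then show ?thesis by simp
  qed
  have "?u 0 \<le> ?u x"
  proof (rule DERIV_nonneg_imp_nondecreasing[OF x])
    fix r assume "0 \<le> r" "r \<le> x"
    moreover have "(?u has_real_derivative ?u' r) (at r)"
      by (auto intro!: derivative_eq_intros f' simp: power2_eq_square)
    ultimately show "\<exists>y. (?u has_real_derivative y) (at r) \<and> 0 \<le> y"
      using u'_nonneg by blast
  qed
  then show ?thesis by simp
qed

text \<open>For negative \<open>x\<close> the function is reflected: the first derivative changes
  sign, the second does not.\<close>

lemma taylor_second_order_le:
  fixes f f' f'' :: "real \<Rightarrow> real"
  assumes f': "\<And>t. (f has_real_derivative f' t) (at t)"
    and f'': "\<And>t. (f' has_real_derivative f'' t) (at t)"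
    and lip: "\<And>t. \<bar>f'' t - f'' 0\<bar> \<le> K * \<bar>t\<bar>"
  shows "f x - f 0 - f' 0 * x - f'' 0 / 2 * x\<^sup>2 \<le> K * \<bar>x\<bar> ^ 3 / 6"
proof (cases "0 \<le> x")
  case True
  have "f'' t - f'' 0 \<le> K * t" if "0 \<le> t" for t
    using lip[of t] that by simp
  from taylor_second_order_upper[OF f' f'' this True] show ?thesis using True by simp
next
  case False
  have 1: "((\<lambda>t. f (-t)) has_real_derivative - f' (-t)) (at t)" for t
    using DERIV_mirror[of f "f' (-t)" t] f'[of "-t"] by simp
  have 2: "((\<lambda>t. - f' (-t)) has_real_derivative f'' (-t)) (at t)" for t
    using DERIV_minus[OF DERIV_mirror[THEN iffD1, OF f''[of "-t"]]] by simp
  have 3: "f'' (-t) - f'' (- 0) \<le> K * t" if "0 \<le> t" for t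
    using lip[of "-t"] that by simp
  have "0 \<le> - x" using False by simp
  from taylor_second_order_upper[OF 1 2 3 this] show ?thesis using False by simp
qed

lemma exp_average_minus: "exp_average c (\<lambda>x. - h x) x = - exp_average c h x"
  by (simp add: exp_average_def)

lemma laplace_smoothing_minus: "laplace_smoothing b (\<lambda>x. - h x) x = - laplace_smoothing b h x"
  unfolding laplace_smoothing_def exp_average_minus by (simp add: field_simps)

text \<open>Since \<open>sin\<close> is odd, the two one-sided averages at 0 cancel.\<close>

lemma laplace_smoothing_sin_0: "laplace_smoothing b sin 0 = 0"
  using exp_average_reflect[of b sin 0] exp_average_minus[of b sin 0]
  by (simp add: laplace_smoothing_def)

lemma lipschitz_growth:
  fixes h :: "real \<Rightarrow> real"
  assumes "K-lipschitz_on UNIV h"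
  shows "\<bar>h x\<bar> \<le> (\<bar>h 0\<bar> + K) * (1 + \<bar>x\<bar>)"
proof -
  have "0 \<le> \<bar>h 0\<bar> * \<bar>x\<bar>" "0 \<le> K" using assms by (auto simp: lipschitz_on_def)
  moreover have "(\<bar>h 0\<bar> + K) * (1 + \<bar>x\<bar>) = \<bar>h 0\<bar> + K * \<bar>x\<bar> + (\<bar>h 0\<bar> * \<bar>x\<bar> + K)"
    by (simp add: algebra_simps)
  ultimately show ?thesis using lipschitz_linear_growth[OF assms, of x] by linarith
qed

text \<open>A Lipschitz substitute for the indicator of a half-line: it stays at 1 up to
  \<open>c\<close> and falls linearly to 0 at \<open>c + \<delta>\<close>.\<close>

definition ramp :: "real \<Rightarrow> real \<Rightarrow> real \<Rightarrow> real" where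
  "ramp c \<delta> x = max 0 (min 1 ((c + \<delta> - x) / \<delta>))"

lemma ramp_lipschitz: "0 < \<delta> \<Longrightarrow> (1 / \<delta>)-lipschitz_on UNIV (ramp c \<delta>)"
proof -
  assume d: "0 < \<delta>"
  have "\<bar>ramp c \<delta> x - ramp c \<delta> y\<bar> \<le> 1 / \<delta> * \<bar>x - y\<bar>" for x y
  proof -
    have "\<bar>ramp c \<delta> x - ramp c \<delta> y\<bar> \<le> \<bar>(c + \<delta> - x) / \<delta> - (c + \<delta> - y) / \<delta>\<bar>"
      unfolding ramp_def by linarith
    also have "\<dots> = \<bar>(y - x) / \<delta>\<bar>" by (simp add: diff_divide_distrib)
    also have "\<dots> = 1 / \<delta> * \<bar>x - y\<bar>" using d by (simp add: abs_divide abs_minus_commute)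
    finally show ?thesis .
  qed
  then show ?thesis using d by (simp add: lipschitz_on_real_iff)
qed

lemma ramp_bounds: "0 \<le> ramp c \<delta> x" "ramp c \<delta> x \<le> 1"
  by (auto simp: ramp_def)

lemma ramp_eq_1: "0 < \<delta> \<Longrightarrow> x \<le> c \<Longrightarrow> ramp c \<delta> x = 1"
  by (simp add: ramp_def min_absorb1)

lemma ramp_eq_0: "0 < \<delta> \<Longrightarrow> c + \<delta> \<le> x \<Longrightarrow> ramp c \<delta> x = 0"
  by (simp add: ramp_def max_absorb1 min.coboundedI2 divide_nonpos_pos)

text \<open>The ramp lies between the indicators of \<open>{..c}\<close> and
  \<open>{..c + \<delta>}\<close>.\<close>

lemma
  assumes b: "0 < b" and d: "0 < \<delta>"
  shows laplace_ramp_le: "(\<integral>x. ramp c \<delta> x \<partial>laplace_measure b) \<le> cdf_of (laplace_measure b) (c + \<delta>)"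
    and laplace_ramp_ge: "cdf_of (laplace_measure b) c \<le> (\<integral>x. ramp c \<delta> x \<partial>laplace_measure b)"
proof -
  interpret prob_space "laplace_measure b" by (rule prob_space_laplace_measure[OF b])
  have cdf: "cdf_of (laplace_measure b) y = (\<integral>x. indicator {..y} x \<partial>laplace_measure b)" for y
    by (simp add: cdf_of_def)
  have i: "integrable (laplace_measure b) (indicator {..y} :: real \<Rightarrow> real)" for y
    by (rule integrable_const_bound[where B=1]) auto
  note r = integrable_laplace_lipschitz[OF ramp_lipschitz[OF d] b]
  show "(\<integral>x. ramp c \<delta> x \<partial>laplace_measure b) \<le> cdf_of (laplace_measure b) (c + \<delta>)"
    unfolding cdf by (intro integral_mono r i) (use ramp_bounds ramp_eq_0[OF d] in \<open>auto simp: indicator_def\<close>)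
  show "cdf_of (laplace_measure b) c \<le> (\<integral>x. ramp c \<delta> x \<partial>laplace_measure b)"
    unfolding cdf by (intro integral_mono r i) (use ramp_bounds ramp_eq_1[OF d] in \<open>auto simp: indicator_def\<close>)
qed

section \<open>Upper bounds for the geometric sum\<close>

context geometric_compound
begin

text \<open>The scale at which the Laplace variance \<open>2 * b^2\<close> equals \<sigma>^2, the
  variance of \<open>W\<close>.\<close>

definition b :: real where "b = \<sigma> / sqrt 2"

lemma b_pos: "0 < b"
  using sigma_pos by (simp add: b_def)

lemma b_square: "b\<^sup>2 = \<sigma>\<^sup>2 / 2"
  by (simp add: b_def power_divide)

lemma integrable_law_growth:
  assumes f [measurable]: "f \<in> borel_measurable borel" and "\<And>x. \<bar>f x\<bar> \<le> C * (1 + \<bar>x\<bar>)" and i: "i \<ge> 1"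
  shows "integrable (law i) (\<lambda>x. f (sqrt p * (s + x)))"
proof -
  have [measurable]: "X i \<in> borel_measurable M" using X_meas[OF i] .
  have "integrable M (\<lambda>\<omega>. f (sqrt p * (s + X i \<omega>)))"
    by (rule integrable_growth[OF assms(1,2)]) (use int_X[OF i] in auto)
  then show ?thesis by (simp add: integrable_distr_eq)
qed

lemma integrable_law_lipschitz:
  fixes f :: "real \<Rightarrow> real"
  assumes "K-lipschitz_on UNIV f" and i: "i \<ge> 1"
  shows "integrable (law i) (\<lambda>x. f (sqrt p * (s + x)))"
  by (rule integrable_law_growth[OF lipschitz_borel_measurable[OF assms(1)] lipschitz_growth[OF assms(1)] i])

text \<open>These are the derivatives of \<open>g\<close> as a function of a single summand
  \<open>x\<close> with the past \<open>s\<close> fixed. The chain rule contributes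
  \<open>sqrt p\<close> twice, and the Stein equation rewrites the second derivative through
  \<open>g - h\<close>.\<close>

lemma smoothing_shift_derivatives:
  fixes s :: real
  assumes h: "K-lipschitz_on UNIV h"
  defines "G' \<equiv> \<lambda>x. sqrt p * ((exp_average (-b) h (sqrt p * (s + x)) - exp_average b h (sqrt p * (s + x))) / (2 * b))"
    and "G'' \<equiv> \<lambda>x. p * ((laplace_smoothing b h (sqrt p * (s + x)) - h (sqrt p * (s + x))) / b\<^sup>2)"
  shows "((\<lambda>x. laplace_smoothing b h (sqrt p * (s + x))) has_real_derivative G' x) (at x)"
    and "(G' has_real_derivative G'' x) (at x)"
proof -
  let ?l = "\<lambda>x. sqrt p * (s + x)"
  have l: "(?l has_real_derivative sqrt p) (at x)"
    by (auto intro!: derivative_eq_intros)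
  show "((\<lambda>x. laplace_smoothing b h (?l x)) has_real_derivative G' x) (at x)"
    using DERIV_chain2[OF laplace_smoothing_has_derivative[OF h b_pos, of "?l x"] l]
    unfolding G'_def by (simp add: mult.commute)
  have "(G' has_real_derivative sqrt p * ((laplace_smoothing b h (?l x) - h (?l x)) / b\<^sup>2 * sqrt p)) (at x)"
    unfolding G'_def
    by (rule DERIV_cmult) (rule DERIV_chain2[where g="?l", OF laplace_smoothing_has_second_derivative[OF h b_pos, of "?l x"] l])
  also have "sqrt p * ((laplace_smoothing b h (?l x) - h (?l x)) / b\<^sup>2 * sqrt p) =
      (sqrt p * sqrt p) * ((laplace_smoothing b h (?l x) - h (?l x)) / b\<^sup>2)"
    by (simp only: mult_ac)
  also have "\<dots> = G'' x" using p unfolding G''_def by simp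
  finally show "(G' has_real_derivative G'' x) (at x)" .
qed

text \<open>Mean zero removes the linear Taylor term, and the variance makes the quadratic one
  cancel \<open>- p * w0\<close>. What remains is the change of \<open>g - h\<close> over one step,
  controlled by the first absolute moment, and the Taylor remainder, controlled by the
  third.\<close>

lemma expectation_W_le_lipschitz:
  assumes h: "1-lipschitz_on UNIV h"
    and int3: "\<And>i. i \<ge> 1 \<Longrightarrow> integrable M (\<lambda>\<omega>. \<bar>X i \<omega>\<bar> ^ 3)"
    and \<rho>: "\<And>i. i \<ge> 1 \<Longrightarrow> (\<integral>\<omega>. \<bar>X i \<omega>\<bar> ^ 3 \<partial>M) \<le> \<rho>"
  shows "(\<integral>\<omega>. h (compound_W p N X \<omega>) \<partial>M) \<le> laplace_smoothing b h 0 + 2 * sqrt p * (\<sigma> + \<rho> / (3 * \<sigma>\<^sup>2))"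
proof -
  define g where "g = laplace_smoothing b h"
  have g: "1-lipschitz_on UNIV g" unfolding g_def by (rule laplace_smoothing_lipschitz[OF h])
  have "(\<integral>\<omega>. h (compound_W p N X \<omega>) \<partial>M) \<le> g 0 + 2 * sqrt p * (\<sigma> + \<rho> / (3 * \<sigma>\<^sup>2))"
  proof (rule expectation_W_le[OF lipschitz_borel_measurable[OF h] lipschitz_growth[OF h]
        lipschitz_borel_measurable[OF g] lipschitz_growth[OF g]])
    fix i :: nat and s :: real assume i: "i \<ge> 1"
    have [measurable]: "X i \<in> borel_measurable M" using X_meas[OF i] .
    interpret law: prob_space "law i" by (rule prob_space_law[OF i])
    \<comment> \<open>By the Stein equation \<open>w\<close> is \<open>b^2\<close> times the second
      derivative of \<open>g\<close>. Its Lipschitz constant is 2 because \<open>g\<close> and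
      \<open>h\<close> are both 1-Lipschitz.\<close>
    define w where "w x = g x - h x" for x
    have w: "\<bar>w x - w y\<bar> \<le> 2 * \<bar>x - y\<bar>" for x y
    proof -
      have "\<bar>h x - h y\<bar> \<le> 1 * \<bar>x - y\<bar>" "\<bar>g x - g y\<bar> \<le> 1 * \<bar>x - y\<bar>"
        using h g unfolding lipschitz_on_real_iff by blast+
      then show ?thesis unfolding w_def by linarith
    qed
    have w_near: "\<bar>w (sqrt p * (s + x)) - w (sqrt p * s)\<bar> \<le> 2 * (sqrt p * \<bar>x\<bar>)" for x
    proof -
      have "sqrt p * (s + x) - sqrt p * s = sqrt p * x" by (simp add: algebra_simps)
      moreover have "\<bar>sqrt p * x\<bar> = sqrt p * \<bar>x\<bar>" using p by (simp add: abs_mult)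
      ultimately show ?thesis using w[of "sqrt p * (s + x)" "sqrt p * s"] by simp
    qed
    define G'0 where "G'0 = sqrt p * ((exp_average (-b) h (sqrt p * s) - exp_average b h (sqrt p * s)) / (2 * b))"
    define w0 where "w0 = w (sqrt p * s)"
    have taylor: "g (sqrt p * (s + x)) - g (sqrt p * s) - G'0 * x - p * (w0 / b\<^sup>2) / 2 * x\<^sup>2
        \<le> p / b\<^sup>2 * 2 * sqrt p * \<bar>x\<bar> ^ 3 / 6" for x
    proof -
      note D = smoothing_shift_derivatives[OF h, of s, folded g_def]
      have "\<bar>p * ((g (sqrt p * (s + t)) - h (sqrt p * (s + t))) / b\<^sup>2) - p * ((g (sqrt p * (s + 0)) - h (sqrt p * (s + 0))) / b\<^sup>2)\<bar>
          \<le> p / b\<^sup>2 * 2 * sqrt p * \<bar>t\<bar>" for t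
      proof -
        have "\<bar>p * ((g (sqrt p * (s + t)) - h (sqrt p * (s + t))) / b\<^sup>2) - p * ((g (sqrt p * (s + 0)) - h (sqrt p * (s + 0))) / b\<^sup>2)\<bar>
            = \<bar>p / b\<^sup>2 * (w (sqrt p * (s + t)) - w (sqrt p * s))\<bar>"
          by (simp add: w_def diff_divide_distrib right_diff_distrib)
        also have "\<dots> = p / b\<^sup>2 * \<bar>w (sqrt p * (s + t)) - w (sqrt p * s)\<bar>"
          using p by (simp add: abs_mult)
        also have "\<dots> \<le> p / b\<^sup>2 * (2 * (sqrt p * \<bar>t\<bar>))"
          using p by (intro mult_left_mono w_near) auto
        finally show ?thesis by (simp add: mult_ac)
      qed
      from taylor_second_order_le[OF D this, of x] show ?thesis
        by (simp add: G'0_def w0_def w_def)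
    qed
    have m: "integrable (law i) (\<lambda>x. \<bar>x\<bar>)" "integrable (law i) (\<lambda>x. \<bar>x\<bar> ^ 3)"
      using int_X[OF i] int3[OF i] by (simp_all add: integrable_distr_eq)
    have E1: "(\<integral>x. \<bar>x\<bar> \<partial>law i) \<le> \<sigma>" and E3: "(\<integral>x. \<bar>x\<bar> ^ 3 \<partial>law i) \<le> \<rho>"
      using expectation_abs_X_le[OF i] \<rho>[OF i] by (simp_all add: integral_distr)
    note I = integrable_law_lipschitz[OF h i] integrable_law_lipschitz[OF g i]
      integrable_law_id[OF i] integrable_law_square[OF i] m
    have "(\<integral>x. p * (h (sqrt p * (s + x)) - g (sqrt p * (s + x))) + g (sqrt p * (s + x)) - g (sqrt p * s) \<partial>law i)
        \<le> (\<integral>x. G'0 * x + p * (w0 / b\<^sup>2) / 2 * x\<^sup>2 - p * w0 + (2 * p * sqrt p) * \<bar>x\<bar> + (p / b\<^sup>2 * 2 * sqrt p / 6) * \<bar>x\<bar> ^ 3 \<partial>law i)"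
    proof (rule integral_mono)
      fix x
      have "- w (sqrt p * (s + x)) \<le> - w0 + 2 * (sqrt p * \<bar>x\<bar>)"
        using w_near[of x] unfolding w0_def by linarith
      then have "p * (- w (sqrt p * (s + x))) \<le> p * (- w0 + 2 * (sqrt p * \<bar>x\<bar>))"
        using p by (intro mult_left_mono) auto
      then have "p * (h (sqrt p * (s + x)) - g (sqrt p * (s + x))) \<le> - (p * w0) + (2 * p * sqrt p) * \<bar>x\<bar>"
        by (simp add: w_def algebra_simps)
      then show "p * (h (sqrt p * (s + x)) - g (sqrt p * (s + x))) + g (sqrt p * (s + x)) - g (sqrt p * s)
          \<le> G'0 * x + p * (w0 / b\<^sup>2) / 2 * x\<^sup>2 - p * w0 + (2 * p * sqrt p) * \<bar>x\<bar> + (p / b\<^sup>2 * 2 * sqrt p / 6) * \<bar>x\<bar> ^ 3"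
        using taylor[of x] by simp
    qed (intro Bochner_Integration.integrable_add Bochner_Integration.integrable_diff integrable_mult_right I law.integrable_const)+
    also have "\<dots> = G'0 * 0 + p * (w0 / b\<^sup>2) / 2 * \<sigma>\<^sup>2 - p * w0 + (2 * p * sqrt p) * (\<integral>x. \<bar>x\<bar> \<partial>law i)
        + (p / b\<^sup>2 * 2 * sqrt p / 6) * (\<integral>x. \<bar>x\<bar> ^ 3 \<partial>law i)"
      using I integral_law_id[OF i] integral_law_square[OF i]
      by (simp add: law.prob_space del: space_distr)
    \<comment> \<open>Here \<open>b^2 = \<sigma>^2 / 2\<close> turns the quadratic term into exactly
      \<open>p * w0\<close>.\<close>
    also have "\<dots> = (2 * p * sqrt p) * (\<integral>x. \<bar>x\<bar> \<partial>law i) + (p / b\<^sup>2 * 2 * sqrt p / 6) * (\<integral>x. \<bar>x\<bar> ^ 3 \<partial>law i)"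
      using sigma_pos by (simp add: b_square)
    also have "\<dots> \<le> (2 * p * sqrt p) * \<sigma> + (p / b\<^sup>2 * 2 * sqrt p / 6) * \<rho>"
      using p by (intro add_mono mult_left_mono E1 E3) auto
    also have "\<dots> = p * (2 * sqrt p * (\<sigma> + \<rho> / (3 * \<sigma>\<^sup>2)))"
      using sigma_pos by (simp add: b_square field_simps)
    finally show "(\<integral>x. p * (h (sqrt p * (s + x)) - g (sqrt p * (s + x))) + g (sqrt p * (s + x)) - g (sqrt p * s) \<partial>law i)
        \<le> p * (2 * sqrt p * (\<sigma> + \<rho> / (3 * \<sigma>\<^sup>2)))" .
  qed
  then show ?thesis by (simp add: g_def)
qed

lemma wasserstein_bound:
  assumes int3: "\<And>i. i \<ge> 1 \<Longrightarrow> integrable M (\<lambda>\<omega>. \<bar>X i \<omega>\<bar> ^ 3)"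
    and \<rho>: "\<And>i. i \<ge> 1 \<Longrightarrow> (\<integral>\<omega>. \<bar>X i \<omega>\<bar> ^ 3 \<partial>M) \<le> \<rho>"
  shows "wasserstein_dist (distr M borel (compound_W p N X)) (laplace_measure b)
    \<le> ereal (2 * sqrt p * (\<sigma> + \<rho> / (3 * \<sigma>\<^sup>2)))"
  unfolding wasserstein_dist_def
proof (rule SUP_least)
  fix h :: "real \<Rightarrow> real" assume "h \<in> {h. \<forall>x y. \<bar>h x - h y\<bar> \<le> \<bar>x - y\<bar>}"
  \<comment> \<open>The one-sided estimate is applied to \<open>h\<close> and to
    \<open>- h\<close>.\<close>
  then have h: "1-lipschitz_on UNIV h" and h': "1-lipschitz_on UNIV (\<lambda>x. - h x)"
    by (auto simp: lipschitz_on_real_iff abs_minus_commute)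
  have [measurable]: "h \<in> borel_measurable borel" by (rule lipschitz_borel_measurable[OF h])
  have "(\<integral>x. h x \<partial>distr M borel (compound_W p N X)) = (\<integral>\<omega>. h (compound_W p N X \<omega>) \<partial>M)"
    by (rule integral_distr) auto
  moreover have "(\<integral>x. h x \<partial>laplace_measure b) = laplace_smoothing b h 0"
    by (rule integral_laplace_lipschitz[OF h b_pos])
  ultimately show "ereal \<bar>(\<integral>x. h x \<partial>distr M borel (compound_W p N X)) - (\<integral>x. h x \<partial>laplace_measure b)\<bar>
      \<le> ereal (2 * sqrt p * (\<sigma> + \<rho> / (3 * \<sigma>\<^sup>2)))"
    using expectation_W_le_lipschitz[OF h int3 \<rho>] expectation_W_le_lipschitz[OF h' int3 \<rho>]
    by (simp add: laplace_smoothing_minus)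
qed

text \<open>Two functions appear so that \<open>k\<close> may be a discontinuous indicator while the
  Stein equation is solved for a Lipschitz \<open>h\<close> dominating it up to the coupling
  distance. The extra term is the change of \<open>g\<close> over that distance.\<close>

lemma expectation_W_le_quantile:
  assumes L: "\<And>i. i \<ge> 1 \<Longrightarrow> centered_equilibrium (law i) (L i)"
    and close: "\<And>i u. i \<ge> 1 \<Longrightarrow> u \<in> {0<..<1} \<Longrightarrow> \<bar>gen_inverse (law i) u - gen_inverse (L i) u\<bar> \<le> \<beta>"
    and k: "k \<in> borel_measurable borel" "\<And>x. \<bar>k x\<bar> \<le> 1"
    and h: "K-lipschitz_on UNIV h" "\<And>x. \<bar>h x\<bar> \<le> 1"
    and kh: "\<And>x y. \<bar>x - y\<bar> \<le> sqrt p * \<beta> \<Longrightarrow> k x \<le> h y"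
  shows "(\<integral>\<omega>. k (compound_W p N X \<omega>) \<partial>M) \<le> (\<integral>x. h x \<partial>laplace_measure b) + sqrt p * \<beta> / b"
proof -
  define g where "g = laplace_smoothing b h"
  have g: "K-lipschitz_on UNIV g" unfolding g_def by (rule laplace_smoothing_lipschitz[OF h(1)])
  have g_lip: "\<bar>g x - g y\<bar> \<le> 1 / b * \<bar>x - y\<bar>" for x y
    using laplace_smoothing_lipschitz_of_bounded[OF h(1) b_pos h(2)]
    unfolding g_def lipschitz_on_real_iff by blast
  have g_bd: "\<bar>g x\<bar> \<le> 1" for x
    unfolding g_def by (rule laplace_smoothing_bound[OF h])
  have k_growth: "\<bar>k x\<bar> \<le> 1 * (1 + \<bar>x\<bar>)" for x
    using k(2)[of x] by simp
  have [measurable]: "k \<in> borel_measurable borel" "h \<in> borel_measurable borel" "g \<in> borel_measurable borel"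
    using k(1) lipschitz_borel_measurable[OF h(1)] lipschitz_borel_measurable[OF g] by auto
  have "(\<integral>\<omega>. k (compound_W p N X \<omega>) \<partial>M) \<le> g 0 + sqrt p * \<beta> / b"
  proof (rule expectation_W_le[OF k(1) k_growth lipschitz_borel_measurable[OF g] lipschitz_growth[OF g]])
    fix i :: nat and s :: real assume i: "i \<ge> 1"
    interpret law: prob_space "law i" by (rule prob_space_law[OF i])
    interpret L: prob_space "L i" using L[OF i] by (simp add: centered_equilibrium_def)
    have setsL [measurable_cong]: "sets (L i) = sets borel" using L[OF i] by (simp add: centered_equilibrium_def)
    let ?l = "\<lambda>x. sqrt p * (s + x)"
    have Ik: "integrable (law i) (\<lambda>x. k (?l x))" by (rule integrable_law_growth[OF k(1) k_growth i])
    have Ig: "integrable (law i) (\<lambda>x. g (?l x))" by (rule integrable_law_lipschitz[OF g i])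
    have IgL: "integrable (L i) (\<lambda>x. g (?l x))" and IhL: "integrable (L i) (\<lambda>x. h (?l x))"
      by (rule L.integrable_const_bound[where B=1]; use g_bd h(2) in \<open>simp; measurable\<close>)+
    have stein: "(\<integral>x. f x \<partial>law i) - f 0 = 1/2 * (\<integral>x. x\<^sup>2 \<partial>law i) * (\<integral>x. f'' x \<partial>L i)"
      if "\<And>x. (f has_real_derivative f' x) (at x)" "\<And>x. (f' has_real_derivative f'' x) (at x)"
        "integrable (law i) f" "integrable (L i) f''" for f f' f''
      using L[OF i] that unfolding centered_equilibrium_def by blast
    \<comment> \<open>The equilibrium identity makes the increment exact: the factor
      \<open>\<sigma>^2 / 2\<close> cancels \<open>b^2\<close> and leaves \<open>p\<close>.\<close>
    have "(\<integral>x. g (?l x) \<partial>law i) - g (?l 0) = 1/2 * (\<integral>x. x\<^sup>2 \<partial>law i) * (\<integral>x. p * ((g (?l x) - h (?l x)) / b\<^sup>2) \<partial>L i)"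
      by (rule stein[OF smoothing_shift_derivatives[OF h(1), of s, folded g_def] Ig])
        (use IgL IhL in simp)
    also have "\<dots> = p * ((\<integral>x. g (?l x) \<partial>L i) - (\<integral>x. h (?l x) \<partial>L i))"
      using IgL IhL sigma_pos by (simp add: integral_law_square[OF i] b_square)
    finally have eq: "(\<integral>x. g (?l x) \<partial>law i) - g (sqrt p * s) = p * ((\<integral>x. g (?l x) \<partial>L i) - (\<integral>x. h (?l x) \<partial>L i))"
      by simp
    \<comment> \<open>Quantile coupling passes from the law of the summand to its equilibrium law,
      where \<open>eq\<close> expresses the increment.\<close>
    have "(\<integral>x. k (?l x) - g (?l x) \<partial>law i) \<le> (\<integral>y. h (?l y) - g (?l y) + sqrt p * \<beta> / b \<partial>L i)"
    proof (rule quantile_coupling_integral_mono[where \<beta>=\<beta>])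
      fix x y :: real assume "\<bar>x - y\<bar> \<le> \<beta>"
      then have "sqrt p * \<bar>x - y\<bar> \<le> sqrt p * \<beta>" using p by (intro mult_left_mono) auto
      moreover have "\<bar>?l x - ?l y\<bar> = sqrt p * \<bar>x - y\<bar>"
      proof -
        have "?l x - ?l y = sqrt p * (x - y)" by (simp add: algebra_simps)
        then show ?thesis using p by (simp add: abs_mult)
      qed
      ultimately have d: "\<bar>?l x - ?l y\<bar> \<le> sqrt p * \<beta>" by simp
      have "g (?l y) - g (?l x) \<le> 1 / b * \<bar>?l x - ?l y\<bar>"
        using g_lip[of "?l x" "?l y"] by linarith
      also have "\<dots> \<le> 1 / b * (sqrt p * \<beta>)"
        using d b_pos by (intro mult_left_mono) auto
      finally show "k (?l x) - g (?l x) \<le> h (?l y) - g (?l y) + sqrt p * \<beta> / b"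
        using kh[OF d] by simp
    qed (use i close Ik Ig IgL IhL law.prob_space_axioms L.prob_space_axioms setsL in auto)
    also have "\<dots> = (\<integral>y. h (?l y) \<partial>L i) - (\<integral>y. g (?l y) \<partial>L i) + sqrt p * \<beta> / b"
      using IgL IhL by (simp add: L.prob_space)
    finally have "p * (\<integral>x. k (?l x) - g (?l x) \<partial>law i) \<le> p * ((\<integral>y. h (?l y) \<partial>L i) - (\<integral>y. g (?l y) \<partial>L i) + sqrt p * \<beta> / b)"
      using p by (intro mult_left_mono) auto
    moreover have "(\<integral>x. p * (k (?l x) - g (?l x)) + g (?l x) - g (sqrt p * s) \<partial>law i) =
        p * (\<integral>x. k (?l x) - g (?l x) \<partial>law i) + ((\<integral>x. g (?l x) \<partial>law i) - g (sqrt p * s))"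
      using Ik Ig by (simp add: law.prob_space del: space_distr)
    \<comment> \<open>The means of \<open>h\<close> and \<open>g\<close> under \<open>L i\<close>
      cancel against those in \<open>eq\<close>; only the coupling cost is left.\<close>
    ultimately show "(\<integral>x. p * (k (?l x) - g (?l x)) + g (?l x) - g (sqrt p * s) \<partial>law i) \<le> p * (sqrt p * \<beta> / b)"
      unfolding eq by (simp add: algebra_simps)
  qed
  then show ?thesis by (simp add: g_def integral_laplace_lipschitz[OF h(1) b_pos])
qed

text \<open>Two errors of size \<open>\<delta> / b\<close> add up: one from the coupling, one from
  moving the Laplace threshold by \<open>2 * \<delta>\<close>, where the density is at most
  \<open>1 / (2 * b)\<close>.\<close>

lemma cdf_difference_bound:
  assumes L: "\<And>i. i \<ge> 1 \<Longrightarrow> centered_equilibrium (law i) (L i)"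
    and close: "\<And>i u. i \<ge> 1 \<Longrightarrow> u \<in> {0<..<1} \<Longrightarrow> \<bar>gen_inverse (law i) u - gen_inverse (L i) u\<bar> \<le> \<beta>"
    and \<beta>: "0 < \<beta>"
  shows "\<bar>cdf_of (distr M borel (compound_W p N X)) a - cdf_of (laplace_measure b) a\<bar> \<le> 2 * (sqrt p * \<beta>) / b"
proof -
  define \<delta> where "\<delta> = sqrt p * \<beta>"
  have d: "0 < \<delta>" using p \<beta> by (simp add: \<delta>_def)
  let ?k = "indicator {..a} :: real \<Rightarrow> real"
  have "cdf_of (distr M borel (compound_W p N X)) a = (\<integral>x. ?k x \<partial>distr M borel (compound_W p N X))"
    by (simp add: cdf_of_def)
  also have "\<dots> = (\<integral>\<omega>. ?k (compound_W p N X \<omega>) \<partial>M)"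
    by (rule integral_distr) auto
  finally have W: "cdf_of (distr M borel (compound_W p N X)) a = (\<integral>\<omega>. ?k (compound_W p N X \<omega>) \<partial>M)" .
  have lip: "(1 / \<delta>)-lipschitz_on UNIV (ramp c \<delta>)" "(1 / \<delta>)-lipschitz_on UNIV (\<lambda>x. - ramp c \<delta> x)" for c
    using ramp_lipschitz[OF d, of c] by (auto simp: lipschitz_on_real_iff abs_minus_commute)
  have bd: "\<bar>ramp c \<delta> x\<bar> \<le> 1" for c x
    using ramp_bounds[of c \<delta> x] by simp
  \<comment> \<open>The ramp starts to fall only at \<open>a + \<delta>\<close>, so it still equals
    1 at every \<open>y\<close> within \<delta> of some \<open>x \<le> a\<close>.\<close>
  have "(\<integral>\<omega>. ?k (compound_W p N X \<omega>) \<partial>M) \<le> (\<integral>x. ramp (a + \<delta>) \<delta> x \<partial>laplace_measure b) + sqrt p * \<beta> / b"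
  proof (rule expectation_W_le_quantile[OF L close _ _ lip(1) bd])
    fix x y assume "\<bar>x - y\<bar> \<le> sqrt p * \<beta>"
    then have "\<bar>x - y\<bar> \<le> \<delta>" by (simp add: \<delta>_def)
    then show "?k x \<le> ramp (a + \<delta>) \<delta> y"
      using ramp_bounds(1)[of "a + \<delta>" \<delta> y] ramp_eq_1[OF d, of y "a + \<delta>"]
      by (auto simp: indicator_def)
  qed auto
  also have "(\<integral>x. ramp (a + \<delta>) \<delta> x \<partial>laplace_measure b) \<le> cdf_of (laplace_measure b) (a + \<delta> + \<delta>)"
    by (rule laplace_ramp_le[OF b_pos d])
  also have "\<dots> \<le> cdf_of (laplace_measure b) a + (a + \<delta> + \<delta> - a) / (2 * b)"
    using d by (intro laplace_cdf_increment b_pos) auto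
  finally have upper: "cdf_of (distr M borel (compound_W p N X)) a \<le> cdf_of (laplace_measure b) a + 2 * \<delta> / b"
    using b_pos by (simp add: W \<delta>_def field_simps)
  \<comment> \<open>For the lower estimate the ramp has reached 0 at \<open>a - \<delta>\<close>,
    hence at every \<open>y\<close> within \<delta> of some \<open>x > a\<close>; negation turns
    this minorant into a majorant.\<close>
  have "(\<integral>\<omega>. - ?k (compound_W p N X \<omega>) \<partial>M) \<le> (\<integral>x. - ramp (a - 2 * \<delta>) \<delta> x \<partial>laplace_measure b) + sqrt p * \<beta> / b"
  proof (rule expectation_W_le_quantile[OF L close _ _ lip(2)])
    fix x y assume "\<bar>x - y\<bar> \<le> sqrt p * \<beta>"
    then have "\<bar>x - y\<bar> \<le> \<delta>" by (simp add: \<delta>_def)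
    then show "- ?k x \<le> - ramp (a - 2 * \<delta>) \<delta> y"
      using ramp_bounds(2)[of "a - 2 * \<delta>" \<delta> y] ramp_eq_0[OF d, of "a - 2 * \<delta>" y]
      by (auto simp: indicator_def)
  qed (use bd in auto)
  moreover have "cdf_of (laplace_measure b) (a - 2 * \<delta>) \<le> (\<integral>x. ramp (a - 2 * \<delta>) \<delta> x \<partial>laplace_measure b)"
    by (rule laplace_ramp_ge[OF b_pos d])
  moreover have "cdf_of (laplace_measure b) a \<le> cdf_of (laplace_measure b) (a - 2 * \<delta>) + (a - (a - 2 * \<delta>)) / (2 * b)"
    using d by (intro laplace_cdf_increment b_pos) auto
  moreover have "(a - (a - 2 * \<delta>)) / (2 * b) = \<delta> / b" "2 * \<delta> / b = \<delta> / b + \<delta> / b" "sqrt p * \<beta> / b = \<delta> / b"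
    using b_pos by (simp_all add: \<delta>_def)
  ultimately have "cdf_of (laplace_measure b) a \<le> cdf_of (distr M borel (compound_W p N X)) a + 2 * \<delta> / b"
    unfolding W by simp
  with upper show ?thesis by (simp add: \<delta>_def abs_le_iff)
qed

lemma kolmogorov_bound:
  assumes L: "\<And>i. i \<ge> 1 \<Longrightarrow> centered_equilibrium (law i) (L i)"
  shows "kolmogorov_dist (distr M borel (compound_W p N X)) (laplace_measure b)
    \<le> ereal (17.04 * sqrt p / \<sigma>) * (SUP i\<in>{1..}. quantile_dist (law i) (L i))"
proof -
  define R where "R = (SUP i\<in>{1..}. quantile_dist (law i) (L i))"
  define c where "c = 17.04 * sqrt p / \<sigma>"
  have c: "0 < c" using p sigma_pos by (simp add: c_def)
  have le_R: "ereal \<bar>gen_inverse (law i) u - gen_inverse (L i) u\<bar> \<le> R" if "i \<ge> 1" "u \<in> {0<..<1}" for i u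
    unfolding R_def quantile_dist_def using that
    by (intro SUP_upper2[of i] SUP_upper2[of u]) auto
  have "0 \<le> R"
    using le_R[of 1 "1/2"] by (auto intro: order_trans[rotated])
  \<comment> \<open>An infinite supremum makes the claim trivial, since the factor \<open>c\<close>
    is positive.\<close>
  then consider (infinite) "R = \<infinity>" | (finite) r where "R = ereal r" "0 \<le> r"
    by (cases R) auto
  then have "kolmogorov_dist (distr M borel (compound_W p N X)) (laplace_measure b) \<le> ereal c * R"
  proof cases
    case infinite
    then show ?thesis using c by simp
  next
    case finite
    have "\<bar>cdf_of (distr M borel (compound_W p N X)) a - cdf_of (laplace_measure b) a\<bar> \<le> c * r" for a
    proof (rule field_le_epsilon)
      fix e :: real assume e: "0 < e"
      \<comment> \<open>The ramps need positive width even when \<open>r = 0\<close>; the excess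
        \<open>e / c\<close> costs exactly \<open>e\<close> after multiplication by
        \<open>c\<close>.\<close>
      define \<beta> where "\<beta> = r + e / c"
      have \<beta>: "r \<le> \<beta>" "0 < \<beta>" using finite(2) c e by (auto simp: \<beta>_def add_nonneg_pos)
      have "\<bar>cdf_of (distr M borel (compound_W p N X)) a - cdf_of (laplace_measure b) a\<bar> \<le> 2 * (sqrt p * \<beta>) / b"
      proof (rule cdf_difference_bound[OF L _ \<beta>(2)])
        fix i :: nat and u :: real assume "1 \<le> i" "u \<in> {0<..<1}"
        from le_R[OF this] show "\<bar>gen_inverse (law i) u - gen_inverse (L i) u\<bar> \<le> \<beta>"
          using finite(1) \<beta>(1) by simp
      qed
      also have "\<dots> = (2 * sqrt 2) * (sqrt p * \<beta> / \<sigma>)"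
        by (simp add: b_def)
      also have "\<dots> \<le> 17.04 * (sqrt p * \<beta> / \<sigma>)"
      proof (rule mult_right_mono)
        have "sqrt 2 \<le> 2" by (rule real_le_lsqrt) auto
        then show "2 * sqrt 2 \<le> 17.04" by simp
      qed (use p \<beta> sigma_pos in auto)
      also have "\<dots> = c * \<beta>" by (simp add: c_def)
      also have "\<dots> = c * r + e" using c by (simp add: \<beta>_def distrib_left)
      finally show "\<bar>cdf_of (distr M borel (compound_W p N X)) a - cdf_of (laplace_measure b) a\<bar> \<le> c * r + e" .
    qed
    then show ?thesis
      unfolding kolmogorov_dist_def finite(1) by (intro SUP_least) simp
  qed
  then show ?thesis by (simp add: R_def c_def)
qed

end

subsection \<open>Lower bound by the characteristic function\<close>

lemma sin_lipschitz: "1-lipschitz_on UNIV (sin :: real \<Rightarrow> real)"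
proof -
  have "\<bar>sin x - sin y\<bar> \<le> \<bar>x - y\<bar>" for x y :: real
  proof -
    have "\<bar>sin x - sin y\<bar> = 2 * \<bar>sin ((x - y) / 2)\<bar> * \<bar>cos ((x + y) / 2)\<bar>"
      by (simp add: sin_diff_sin abs_mult)
    also have "\<dots> \<le> 2 * \<bar>(x - y) / 2\<bar> * 1"
      by (intro mult_mono abs_sin_x_le_abs_x) auto
    finally show ?thesis by simp
  qed
  then show ?thesis by (simp add: lipschitz_on_real_iff)
qed

lemma Im_char_eq_integral_sin:
  assumes "prob_space \<mu>" and [measurable_cong]: "sets \<mu> = sets borel"
  shows "Im (char \<mu> t) = (\<integral>x. sin (t * x) \<partial>\<mu>)"
proof -
  interpret prob_space \<mu> by fact
  have "integrable \<mu> (\<lambda>x. iexp (t * x))"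
    by (rule integrable_iexp) auto
  then have "(\<integral>x. Im (iexp (t * x)) \<partial>\<mu>) = Im (char \<mu> t)"
    unfolding char_def by (rule integral_Im)
  then show ?thesis by (simp add: Im_exp)
qed

text \<open>After multiplying numerator and denominator by the conjugate denominator, the numerator is
  \<open>p \<phi>\<close> minus a real number.\<close>

lemma Im_geometric_transform:
  fixes \<phi> :: complex
  shows "Im (of_real p * \<phi> / (1 - of_real (1 - p) * \<phi>)) = p * Im \<phi> / (cmod (1 - of_real (1 - p) * \<phi>))\<^sup>2"
proof -
  have "Im (of_real p * \<phi> / (1 - of_real (1 - p) * \<phi>)) =
     (p * Im \<phi> * (1 - (1 - p) * Re \<phi>) - p * Re \<phi> * (- ((1 - p) * Im \<phi>))) / (cmod (1 - of_real (1 - p) * \<phi>))\<^sup>2"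
    unfolding Im_divide cmod_power2 by (simp del: of_real_diff)
  also have "p * Im \<phi> * (1 - (1 - p) * Re \<phi>) - p * Re \<phi> * (- ((1 - p) * Im \<phi>)) = p * Im \<phi>"
    by (simp add: algebra_simps)
  finally show ?thesis .
qed

context geometric_compound
begin

text \<open>Characteristic functions multiply over independent summands, so summing over
  \<open>N\<close> gives the imaginary part of a geometric series of ratio
  \<open>(1 - p) * \<phi>\<close>. This ratio has modulus below 1 because
  \<open>cmod \<phi> \<le> 1\<close>.\<close>

lemma expectation_sin_W:
  assumes iid: "\<And>i. i \<ge> 1 \<Longrightarrow> law i = law 1"
  defines "\<phi> \<equiv> char (law 1) (sqrt p)"
  shows "(\<integral>\<omega>. sin (compound_W p N X \<omega>) \<partial>M) = p * Im \<phi> / (cmod (1 - of_real (1 - p) * \<phi>))\<^sup>2"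
    and "1 - of_real (1 - p) * \<phi> \<noteq> 0"
proof -
  have E: "(\<integral>\<omega>. sin (sqrt p * partial_sum n \<omega>) \<partial>M) = Im (\<phi> ^ n)" for n
  proof -
    have "(\<integral>\<omega>. sin (sqrt p * partial_sum n \<omega>) \<partial>M) = (\<integral>x. sin (sqrt p * x) \<partial>distr M borel (partial_sum n))"
      by (rule integral_distr[symmetric]) measurable
    also have "\<dots> = Im (char (distr M borel (partial_sum n)) (sqrt p))"
      by (rule Im_char_eq_integral_sin[symmetric]) (auto intro!: prob_space_distr)
    also have "char (distr M borel (partial_sum n)) (sqrt p) = (\<Prod>i=1..n. char (law i) (sqrt p))"
      by (rule char_distr_sum) (auto intro: indep_vars_subset[OF indep_X])
    also have "\<dots> = (\<Prod>i=1..n. \<phi>)"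
      unfolding \<phi>_def by (intro prod.cong refl arg_cong[where f="\<lambda>\<mu>. char \<mu> (sqrt p)"] iid) simp
    finally show ?thesis by simp
  qed
  interpret law1: real_distribution "law 1" using X_meas[of 1] by simp
  have "cmod \<phi> \<le> 1" unfolding \<phi>_def by (rule law1.cmod_char_le_1)
  then have "(1 - p) * cmod \<phi> \<le> (1 - p) * 1" using p by (intro mult_left_mono) auto
  also have "\<dots> < 1" using p by simp
  finally have "(1 - p) * cmod \<phi> < 1" .
  then have lt: "cmod (of_real (1 - p) * \<phi>) < 1"
    using p unfolding norm_mult norm_of_real by simp
  then show "1 - of_real (1 - p) * \<phi> \<noteq> 0" by auto
  have "(\<lambda>n. of_real p * \<phi> * (of_real (1 - p) * \<phi>) ^ n) sums (of_real p * \<phi> * (1 / (1 - of_real (1 - p) * \<phi>)))"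
    by (intro sums_mult geometric_sums lt)
  then have "(\<lambda>n. Im (of_real p * \<phi> * (of_real (1 - p) * \<phi>) ^ n)) sums Im (of_real p * \<phi> * (1 / (1 - of_real (1 - p) * \<phi>)))"
    by (rule sums_Im)
  moreover have "of_real p * \<phi> * (of_real (1 - p) * \<phi>) ^ n = of_real (p * (1 - p) ^ n) * \<phi> ^ Suc n" for n
    by (simp add: power_mult_distrib mult_ac)
  then have "Im (of_real p * \<phi> * (of_real (1 - p) * \<phi>) ^ n) = p * (1 - p) ^ n * Im (\<phi> ^ Suc n)" for n
    by (simp only: times_complex.sel Im_complex_of_real Re_complex_of_real mult_zero_left add_0_right)
  ultimately have "(\<lambda>n. p * (1 - p) ^ n * Im (\<phi> ^ Suc n)) sums Im (of_real p * \<phi> / (1 - of_real (1 - p) * \<phi>))"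
    by simp
  moreover have "(\<lambda>n. p * (1 - p) ^ n * Im (\<phi> ^ Suc n)) sums (\<integral>\<omega>. sin (compound_W p N X \<omega>) \<partial>M)"
  proof -
    have "\<bar>sin x\<bar> \<le> 1 * (1 + \<bar>x\<bar>)" for x :: real
      by (rule order_trans[OF abs_sin_le_one]) simp
    from expectation_W_sums[OF _ this] show ?thesis unfolding E by simp
  qed
  ultimately show "(\<integral>\<omega>. sin (compound_W p N X \<omega>) \<partial>M) = p * Im \<phi> / (cmod (1 - of_real (1 - p) * \<phi>))\<^sup>2"
    unfolding Im_geometric_transform by (rule sums_unique2[rotated])
qed

text \<open>As \<open>sin\<close> has Laplace mean 0, it suffices to bound the numerator of the
  formula for \<open>E sin W\<close> from below and its denominator from above. The hypothesis
  \<open>small\<close> keeps the fourth-moment error under half of the third-moment term.\<close>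

lemma wasserstein_lower_bound:
  assumes iid: "\<And>i. i \<ge> 1 \<Longrightarrow> law i = law 1"
    and moments: "\<And>k::nat. integrable M (\<lambda>\<omega>. \<bar>X 1 \<omega>\<bar> ^ k)"
    and small: "sqrt p * (\<integral>\<omega>. \<bar>X 1 \<omega>\<bar> ^ 4 \<partial>M) \<le> \<bar>\<integral>\<omega>. X 1 \<omega> ^ 3 \<partial>M\<bar>"
  shows "ereal (\<bar>\<integral>\<omega>. X 1 \<omega> ^ 3 \<partial>M\<bar> / (12 * (1 + 3 / 2 * \<sigma>\<^sup>2)\<^sup>2) * sqrt p)
    \<le> wasserstein_dist (distr M borel (compound_W p N X)) (laplace_measure b)"
proof -
  define \<phi> where "\<phi> = char (law 1) (sqrt p)"
  define m3 where "m3 = (\<integral>\<omega>. X 1 \<omega> ^ 3 \<partial>M)"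
  define m4 where "m4 = (\<integral>\<omega>. \<bar>X 1 \<omega>\<bar> ^ 4 \<partial>M)"
  define B where "B = 1 + 3 / 2 * \<sigma>\<^sup>2"
  have X1 [measurable]: "X 1 \<in> borel_measurable M" by (rule X_meas) simp
  have int: "integrable M (\<lambda>\<omega>. X 1 \<omega> ^ k)" for k
    by (rule Bochner_Integration.integrable_bound[OF moments[of k]]) (auto simp: power_abs)
  interpret law1: real_distribution "law 1" by simp
  have q: "sqrt p > 0" using p by simp
  \<comment> \<open>Second-order expansion, for the denominator: an error of order \<open>p\<close>
    is affordable there.\<close>
  have "cmod (\<phi> - (\<Sum>k\<le>2. (\<i> * sqrt p) ^ k / fact k * expectation (\<lambda>\<omega>. X 1 \<omega> ^ k)))
      \<le> 2 * \<bar>sqrt p\<bar> ^ 2 / fact 2 * expectation (\<lambda>\<omega>. \<bar>X 1 \<omega>\<bar> ^ 2)"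
    unfolding \<phi>_def by (rule char_approx1'[OF int X1 refl])
  then have A2: "cmod (\<phi> - (1 - complex_of_real (p * \<sigma>\<^sup>2 / 2))) \<le> p * \<sigma>\<^sup>2"
    using p mean_X[of 1] var_X[of 1]
    by (simp add: numeral_2_eq_2 prob_space power_mult_distrib flip: of_real_power of_real_mult)
  \<comment> \<open>Each of the three parts is of order \<open>p\<close>; their bounds add up to
    \<open>p * B\<close>.\<close>
  have "1 - of_real (1 - p) * \<phi> = of_real (p * \<sigma>\<^sup>2 / 2) - (\<phi> - (1 - complex_of_real (p * \<sigma>\<^sup>2 / 2))) + of_real p * \<phi>"
    by (simp add: algebra_simps)
  then have "cmod (1 - of_real (1 - p) * \<phi>) \<le> cmod (complex_of_real (p * \<sigma>\<^sup>2 / 2)) + cmod (\<phi> - (1 - complex_of_real (p * \<sigma>\<^sup>2 / 2))) + cmod (of_real p * \<phi>)"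
    by (metis norm_triangle_le norm_triangle_ineq4 add_mono order_refl)
  also have "\<dots> \<le> p * \<sigma>\<^sup>2 / 2 + p * \<sigma>\<^sup>2 + p * 1"
  proof (intro add_mono A2)
    show "cmod (complex_of_real (p * \<sigma>\<^sup>2 / 2)) \<le> p * \<sigma>\<^sup>2 / 2"
      using p unfolding norm_of_real by simp
    show "cmod (of_real p * \<phi>) \<le> p * 1"
      using p law1.cmod_char_le_1[of "sqrt p"] unfolding \<phi>_def norm_mult norm_of_real
      by (intro mult_mono) auto
  qed
  finally have w_le: "cmod (1 - of_real (1 - p) * \<phi>) \<le> p * B"
    by (simp add: B_def algebra_simps)
  \<comment> \<open>The expansion goes to order four because the remainder at order three would be
    as large as the leading term. Even orders contribute real numbers and the first moment vanishes,
    so only the third moment enters the imaginary part.\<close>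
  have "cmod (\<phi> - (\<Sum>k\<le>4. (\<i> * sqrt p) ^ k / fact k * expectation (\<lambda>\<omega>. X 1 \<omega> ^ k)))
      \<le> 2 * \<bar>sqrt p\<bar> ^ 4 / fact 4 * expectation (\<lambda>\<omega>. \<bar>X 1 \<omega>\<bar> ^ 4)"
    unfolding \<phi>_def by (rule char_approx1'[OF int X1 refl])
  then have "\<bar>Im (\<phi> - (\<Sum>k\<le>4. (\<i> * sqrt p) ^ k / fact k * expectation (\<lambda>\<omega>. X 1 \<omega> ^ k)))\<bar> \<le> sqrt p ^ 4 / 12 * m4"
    using p by (intro order_trans[OF abs_Im_le_cmod]) (simp add: m4_def fact_numeral)
  moreover have "Im (\<Sum>k\<le>4. (\<i> * sqrt p) ^ k / fact k * expectation (\<lambda>\<omega>. X 1 \<omega> ^ k)) = - (sqrt p ^ 3 * m3 / 6)"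
    using mean_X[of 1] by (simp add: eval_nat_numeral fact_numeral m3_def power_mult_distrib)
  ultimately have "\<bar>Im \<phi> + sqrt p ^ 3 * m3 / 6\<bar> \<le> sqrt p ^ 4 / 12 * m4"
    by simp
  moreover have "sqrt p ^ 4 / 12 * m4 \<le> sqrt p ^ 3 * \<bar>m3\<bar> / 12"
  proof -
    have "sqrt p ^ 3 / 12 * (sqrt p * m4) \<le> sqrt p ^ 3 / 12 * \<bar>m3\<bar>"
      using small q by (intro mult_left_mono) (simp_all only: m3_def m4_def, simp)
    moreover have "sqrt p ^ 4 = sqrt p ^ 3 * sqrt p"
      using power_Suc2[of "sqrt p" 3] by (simp del: power_Suc)
    ultimately show ?thesis by (simp only: times_divide_eq_left times_divide_eq_right mult.assoc)
  qed
  moreover have "\<bar>sqrt p ^ 3 * m3 / 6\<bar> = sqrt p ^ 3 * \<bar>m3\<bar> / 6"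
    using p by (simp add: abs_mult)
  ultimately have Im_ge: "sqrt p ^ 3 * \<bar>m3\<bar> / 12 \<le> \<bar>Im \<phi>\<bar>"
    by linarith
  have sinW: "(\<integral>\<omega>. sin (compound_W p N X \<omega>) \<partial>M) = p * Im \<phi> / (cmod (1 - of_real (1 - p) * \<phi>))\<^sup>2"
      "1 - of_real (1 - p) * \<phi> \<noteq> 0"
    unfolding \<phi>_def using expectation_sin_W iid by blast+
  have w_pos: "0 < cmod (1 - of_real (1 - p) * \<phi>)" using sinW(2) by simp
  \<comment> \<open>Powers of \<open>p\<close>: the numerator has exponent 5/2 and the denominator
    2, which leaves \<open>sqrt p\<close>.\<close>
  have "\<bar>m3\<bar> / (12 * B\<^sup>2) * sqrt p = p * (sqrt p ^ 3 * \<bar>m3\<bar> / 12) / (p * B)\<^sup>2"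
    using p by (simp add: power_mult_distrib power2_eq_square power3_eq_cube)
  also have "\<dots> \<le> p * \<bar>Im \<phi>\<bar> / (cmod (1 - of_real (1 - p) * \<phi>))\<^sup>2"
    using p w_pos w_le Im_ge by (intro frac_le mult_left_mono power_mono) auto
  also have "\<dots> = \<bar>\<integral>\<omega>. sin (compound_W p N X \<omega>) \<partial>M\<bar>"
    using p unfolding sinW(1) by (simp add: abs_mult)
  also have "\<dots> = \<bar>(\<integral>x. sin x \<partial>distr M borel (compound_W p N X)) - (\<integral>x. sin x \<partial>laplace_measure b)\<bar>"
    using integral_laplace_lipschitz[OF sin_lipschitz b_pos]
    by (simp add: laplace_smoothing_sin_0 integral_distr)
  finally have "ereal (\<bar>m3\<bar> / (12 * B\<^sup>2) * sqrt p)
      \<le> ereal \<bar>(\<integral>x. sin x \<partial>distr M borel (compound_W p N X)) - (\<integral>x. sin x \<partial>laplace_measure b)\<bar>"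
    by simp
  also have "\<dots> \<le> wasserstein_dist (distr M borel (compound_W p N X)) (laplace_measure b)"
    unfolding wasserstein_dist_def
    using sin_lipschitz by (intro SUP_upper) (simp add: lipschitz_on_real_iff)
  finally show ?thesis by (simp add: m3_def B_def)
qed

end

section \<open>Assembly of the Kolmogorov, Wasserstein and sharpness statements\<close>

theorem theorem5p10:
  fixes M :: "'a measure" and X :: "nat \<Rightarrow> 'a \<Rightarrow> real" and \<sigma> :: real
  assumes M: "prob_space M"
    and meas: "\<And>i. i \<ge> 1 \<Longrightarrow> X i \<in> borel_measurable M"
    and indep: "prob_space.indep_vars M (\<lambda>_. borel) X {1..}"
    and int1: "\<And>i. i \<ge> 1 \<Longrightarrow> integrable M (X i)"
    and int2: "\<And>i. i \<ge> 1 \<Longrightarrow> integrable M (\<lambda>\<omega>. (X i \<omega>) ^ 2)"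
    and mean0: "\<And>i. i \<ge> 1 \<Longrightarrow> (\<integral>\<omega>. X i \<omega> \<partial>M) = 0"
    and var: "\<And>i. i \<ge> 1 \<Longrightarrow> (\<integral>\<omega>. (X i \<omega>) ^ 2 \<partial>M) = \<sigma> ^ 2"
    and sigma_pos: "\<sigma> > 0"
  shows
    "(\<forall>p N L. p \<in> {0<..<1} \<and> geometric_rv M p N \<and> indep_of_seq M N X \<and>
        (\<forall>i\<ge>1. centered_equilibrium (distr M borel (X i)) (L i)) \<longrightarrow>
        kolmogorov_dist (distr M borel (compound_W p N X)) (laplace_measure (\<sigma> / sqrt 2))
          \<le> ereal (17.04 * sqrt p / \<sigma>) *
             (SUP i\<in>{1..}. quantile_dist (distr M borel (X i)) (L i))) \<and>
     (\<forall>p N \<rho>. p \<in> {0<..<1} \<and> geometric_rv M p N \<and> indep_of_seq M N X \<and>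
        (\<forall>i\<ge>1. integrable M (\<lambda>\<omega>. \<bar>X i \<omega>\<bar> ^ 3)) \<and>
        \<rho> = (SUP i\<in>{1..}. (\<integral>\<omega>. \<bar>X i \<omega>\<bar> ^ 3 \<partial>M)) \<and>
        bdd_above ((\<lambda>i. \<integral>\<omega>. \<bar>X i \<omega>\<bar> ^ 3 \<partial>M) ` {1..}) \<longrightarrow>
        wasserstein_dist (distr M borel (compound_W p N X)) (laplace_measure (\<sigma> / sqrt 2))
          \<le> ereal (12 * sqrt p * (\<sigma> + \<rho> / (3 * \<sigma> ^ 2)))) \<and>
     ((\<forall>i\<ge>1. distr M borel (X i) = distr M borel (X 1)) \<and>
     (\<forall>k::nat. integrable M (\<lambda>\<omega>. \<bar>X 1 \<omega>\<bar> ^ k)) \<and>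
     (\<integral>\<omega>. (X 1 \<omega>) ^ 3 \<partial>M) \<noteq> 0 \<longrightarrow>
     (\<exists>c>0. \<exists>p0>0. \<forall>p N. p \<in> {0<..<p0} \<and> p < 1 \<and> geometric_rv M p N \<and> indep_of_seq M N X \<longrightarrow>
        wasserstein_dist (distr M borel (compound_W p N X)) (laplace_measure (\<sigma> / sqrt 2))
          \<ge> ereal (c * sqrt p)))"
proof -
  interpret centered_sequence M X \<sigma>
    by (rule centered_sequence.intro[OF M], unfold_locales) (use assms in auto)
  have compound: "geometric_compound M X \<sigma> p N"
    if "p \<in> {0<..<1}" "geometric_rv M p N" "indep_of_seq M N X" for p N
    by unfold_locales (use that in auto)
  show ?thesis
  proof (intro conjI allI impI)
    fix p N and L :: "nat \<Rightarrow> real measure"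
    assume A: "p \<in> {0<..<1} \<and> geometric_rv M p N \<and> indep_of_seq M N X \<and>
      (\<forall>i\<ge>1. centered_equilibrium (distr M borel (X i)) (L i))"
    then have G: "geometric_compound M X \<sigma> p N" by (intro compound) auto
    show "kolmogorov_dist (distr M borel (compound_W p N X)) (laplace_measure (\<sigma> / sqrt 2))
      \<le> ereal (17.04 * sqrt p / \<sigma>) * (SUP i\<in>{1..}. quantile_dist (distr M borel (X i)) (L i))"
      using geometric_compound.kolmogorov_bound[OF G, of L] A
      by (simp add: geometric_compound.b_def[OF G])
  next
    fix p N \<rho>
    assume A: "p \<in> {0<..<1} \<and> geometric_rv M p N \<and> indep_of_seq M N X \<and>
        (\<forall>i\<ge>1. integrable M (\<lambda>\<omega>. \<bar>X i \<omega>\<bar> ^ 3)) \<and>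
        \<rho> = (SUP i\<in>{1..}. (\<integral>\<omega>. \<bar>X i \<omega>\<bar> ^ 3 \<partial>M)) \<and>
        bdd_above ((\<lambda>i. \<integral>\<omega>. \<bar>X i \<omega>\<bar> ^ 3 \<partial>M) ` {1..})"
    then have G: "geometric_compound M X \<sigma> p N" by (intro compound) auto
    have \<rho>: "(\<integral>\<omega>. \<bar>X i \<omega>\<bar> ^ 3 \<partial>M) \<le> \<rho>" if "i \<ge> 1" for i
      using A that by (auto intro!: cSUP_upper)
    \<comment> \<open>Nonnegativity of \<rho> allows the constant 2 to be enlarged to 12.\<close>
    have "0 \<le> (\<integral>\<omega>. \<bar>X 1 \<omega>\<bar> ^ 3 \<partial>M)" by (rule integral_nonneg_AE) simp
    also have "\<dots> \<le> \<rho>" by (rule \<rho>) simp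
    finally have "0 \<le> \<rho>" .
    then have "0 \<le> sqrt p * (\<sigma> + \<rho> / (3 * \<sigma> ^ 2))"
      using A sigma_pos by (auto intro!: mult_nonneg_nonneg add_nonneg_nonneg)
    then have "ereal (2 * sqrt p * (\<sigma> + \<rho> / (3 * \<sigma> ^ 2))) \<le> ereal (12 * sqrt p * (\<sigma> + \<rho> / (3 * \<sigma> ^ 2)))"
      by (simp add: mult.assoc)
    with geometric_compound.wasserstein_bound[OF G _ \<rho>] A
    show "wasserstein_dist (distr M borel (compound_W p N X)) (laplace_measure (\<sigma> / sqrt 2))
      \<le> ereal (12 * sqrt p * (\<sigma> + \<rho> / (3 * \<sigma> ^ 2)))"
      by (auto simp: geometric_compound.b_def[OF G] intro: order_trans)
  next
    assume A: "(\<forall>i\<ge>1. distr M borel (X i) = distr M borel (X 1)) \<and>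
     (\<forall>k::nat. integrable M (\<lambda>\<omega>. \<bar>X 1 \<omega>\<bar> ^ k)) \<and> (\<integral>\<omega>. (X 1 \<omega>) ^ 3 \<partial>M) \<noteq> 0"
    define m3 where "m3 = \<bar>\<integral>\<omega>. X 1 \<omega> ^ 3 \<partial>M\<bar>"
    define m4 where "m4 = (\<integral>\<omega>. \<bar>X 1 \<omega>\<bar> ^ 4 \<partial>M)"
    define c where "c = m3 / (12 * (1 + 3 / 2 * \<sigma>\<^sup>2)\<^sup>2)"
    have m: "0 < m3" "0 \<le> m4" using A by (auto simp: m3_def m4_def)
    have "0 < 1 + 3 / 2 * \<sigma>\<^sup>2" by (simp add: add_pos_nonneg)
    then have c: "0 < c" using m by (simp add: c_def)
    show "\<exists>c>0. \<exists>p0>0. \<forall>p N. p \<in> {0<..<p0} \<and> p < 1 \<and> geometric_rv M p N \<and> indep_of_seq M N X \<longrightarrow>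
        wasserstein_dist (distr M borel (compound_W p N X)) (laplace_measure (\<sigma> / sqrt 2)) \<ge> ereal (c * sqrt p)"
    \<comment> \<open>The threshold for \<open>p\<close> is chosen so that
      \<open>sqrt p * m4 \<le> m3\<close>; adding 1 to \<open>m4\<close> keeps the divisor
      positive.\<close>
    proof (rule exI[of _ c], intro conjI c, rule exI[of _ "(m3 / (m4 + 1))\<^sup>2"], intro conjI allI impI)
      show "0 < (m3 / (m4 + 1))\<^sup>2" using m by simp
      fix p N assume B: "p \<in> {0<..<(m3 / (m4 + 1))\<^sup>2} \<and> p < 1 \<and> geometric_rv M p N \<and> indep_of_seq M N X"
      then have G: "geometric_compound M X \<sigma> p N" by (intro compound) auto
      have "sqrt p \<le> m3 / (m4 + 1)"
        using B m by (intro real_le_lsqrt) auto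
      then have "sqrt p * (m4 + 1) \<le> m3" using m by (simp add: field_simps)
      moreover have "sqrt p * m4 \<le> sqrt p * (m4 + 1)" using B by (intro mult_left_mono) auto
      ultimately have small: "sqrt p * m4 \<le> m3" by linarith
      have "ereal (c * sqrt p) \<le> wasserstein_dist (distr M borel (compound_W p N X)) (laplace_measure (geometric_compound.b \<sigma>))"
        unfolding c_def m3_def
      proof (rule geometric_compound.wasserstein_lower_bound[OF G])
        show "law i = law 1" if "i \<ge> 1" for i using A that by blast
        show "integrable M (\<lambda>\<omega>. \<bar>X 1 \<omega>\<bar> ^ k)" for k :: nat using A by blast
        show "sqrt p * (\<integral>\<omega>. \<bar>X 1 \<omega>\<bar> ^ 4 \<partial>M) \<le> \<bar>\<integral>\<omega>. X 1 \<omega> ^ 3 \<partial>M\<bar>"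
          using small unfolding m3_def m4_def .
      qed
      then show "wasserstein_dist (distr M borel (compound_W p N X)) (laplace_measure (\<sigma> / sqrt 2)) \<ge> ereal (c * sqrt p)"
        by (simp add: geometric_compound.b_def[OF G])
    qed
  qed
qed

end
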